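(* For any type I Inoue surface $S$, $S$ is not biholomorphic to the conjugate surface $\bar S$. In particular a type I Inoue surface does not admit any Real structure (anti-holomorphic involution).
   Context: $H=\{w\in\mathbb{C}\mid\mathrm{Im}(w)>0\}$, $U=H\times\mathbb{C}$ with coordinates $(w,z)$. A number $\beta\in\mathbb{C}\setminus\mathbb{R}$ with $|\beta|<1$ is admissible if $|\beta|^{-2},\beta,\bar\beta$ are the roots of a polynomial $X^3-\theta_2X^2+\theta_1X-1$ with $\theta_1,\theta_2\in\mathbb{Z}$. For an admissible $\beta$, a pair $(a,b)\in\mathbb{R}^3\times\mathbb{C}^3$ is $\beta$-compatible if $a,b,\bar b$ are linearly independent over $\mathbb{C}$ and, $P$ being the matrix with columns $a,b,\bar b$, $P\,\mathrm{diag}(|\beta|^{-2},\beta,\bar\beta)\,P^{-1}\in M_3(\mathbb{Z})$. The type I Inoue surfaces are the compact complex surfaces $S^{\beta}_{a,b}=U/G(\beta,a,b)$, with $\beta$ admissible and $(a,b)$ $\beta$-compatible, where $G(\beta,a,b)$ is the group (acting properly discontinuously on $U$) generated by $(w,z)\mapsto(|\beta|^{-2}w,\beta z)$ and $(w,z)\mapsto(w+a_i,z+b_i)$, $1\le i\le 3$. For a complex surface $S$, $\bar S$ denotes the same differentiable manifold endowed with the conjugate complex structure. *)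

theory Defs
  imports "HOL-Analysis.Analysis" "HOL-Algebra.Generated_Groups" "HOL-Algebra.Group_Action"
    "HOL-Computational_Algebra.Polynomial"
begin

section \<open>Surfaces with charts in the complex plane of dimension two\<close>

text \<open>Complex differentiability of a map between open sets of \<open>\<complex>\<^sup>2\<close>: the real Frechet
  derivative exists and commutes with complex scalars.\<close>

definition complex_homogeneous :: "(complex \<times> complex \<Rightarrow> complex \<times> complex) \<Rightarrow> bool" where
  "complex_homogeneous D \<longleftrightarrow>
     (\<forall>c w z. D (c * w, c * z) = (c * fst (D (w, z)), c * snd (D (w, z))))"

definition holomorphic2_on ::
  "(complex \<times> complex \<Rightarrow> complex \<times> complex) \<Rightarrow> (complex \<times> complex) set \<Rightarrow> bool" where
  "holomorphic2_on f A \<longleftrightarrow>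
     (\<forall>p\<in>A. \<exists>D. (f has_derivative D) (at p) \<and> complex_homogeneous D)"

text \<open>A chart is a pair of its domain and its coordinate map; only the values of the coordinate
  map on the domain matter. The record carries the data of a complex surface (the topological
  space of its points and a holomorphic atlas); maps of surfaces are only considered on the points,
  that is, on \<open>topspace\<close> of the topology.\<close>

record 'a complex_surface =
  surface_top :: "'a topology"
  surface_atlas :: "('a set \<times> ('a \<Rightarrow> complex \<times> complex)) set"

definition holomorphic_map ::
  "'a complex_surface \<Rightarrow> 'b complex_surface \<Rightarrow> ('a \<Rightarrow> 'b) \<Rightarrow> bool" where
  "holomorphic_map S T f \<longleftrightarrow>
     continuous_map (surface_top S) (surface_top T) f \<and>
     (\<forall>(V, \<phi>) \<in> surface_atlas S. \<forall>(W, \<psi>) \<in> surface_atlas T.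
        holomorphic2_on (\<psi> \<circ> f \<circ> inv_into V \<phi>) (\<phi> ` (V \<inter> f -` W)))"

definition biholomorphic :: "'a complex_surface \<Rightarrow> 'b complex_surface \<Rightarrow> bool" where
  "biholomorphic S T \<longleftrightarrow>
     (\<exists>f g. holomorphic_map S T f \<and> holomorphic_map T S g \<and>
        (\<forall>x \<in> topspace (surface_top S). g (f x) = x) \<and>
        (\<forall>y \<in> topspace (surface_top T). f (g y) = y))"

definition conjugate_surface :: "'a complex_surface \<Rightarrow> 'a complex_surface" where
  "conjugate_surface S =
     \<lparr>surface_top = surface_top S,
      surface_atlas = (\<lambda>(V, \<phi>). (V, map_prod cnj cnj \<circ> \<phi>)) ` surface_atlas S\<rparr>"

definition antiholomorphic_map ::
  "'a complex_surface \<Rightarrow> 'b complex_surface \<Rightarrow> ('a \<Rightarrow> 'b) \<Rightarrow> bool" where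
  "antiholomorphic_map S T f \<longleftrightarrow> holomorphic_map S (conjugate_surface T) f"

definition real_structure :: "'a complex_surface \<Rightarrow> ('a \<Rightarrow> 'a) \<Rightarrow> bool" where
  "real_structure S \<sigma> \<longleftrightarrow>
     antiholomorphic_map S S \<sigma> \<and> (\<forall>x \<in> topspace (surface_top S). \<sigma> (\<sigma> x) = x)"


section \<open>Quotients of open subsets of the plane of dimension two\<close>

text \<open>The elements of \<open>G\<close> are themselves bijections of \<open>U\<close>, so the action is evaluation.
  The charts of the quotient are the inverses of the projection on the open sets where the
  projection is injective. They cover the quotient and form a holomorphic atlas when \<open>G\<close> consists
  of biholomorphisms and acts freely and properly discontinuously.\<close>

abbreviation orbit_proj :: "('p \<Rightarrow> 'p) monoid \<Rightarrow> 'p \<Rightarrow> 'p set" where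
  "orbit_proj G \<equiv> orbit G (\<lambda>g. g)"

definition orbit_topology :: "'p::topological_space set \<Rightarrow> ('p \<Rightarrow> 'p) monoid \<Rightarrow> 'p set topology" where
  "orbit_topology U G =
     topology (\<lambda>W. W \<subseteq> orbit_proj G ` U \<and> openin (top_of_set U) (U \<inter> orbit_proj G -` W))"

lemma openin_orbit_topology:
  "openin (orbit_topology U G) W \<longleftrightarrow>
     W \<subseteq> orbit_proj G ` U \<and> openin (top_of_set U) (U \<inter> orbit_proj G -` W)"
proof -
  have "istopology (\<lambda>W. W \<subseteq> orbit_proj G ` U \<and> openin (top_of_set U) (U \<inter> orbit_proj G -` W))"
  proof -
    have 1: "U \<inter> orbit_proj G -` (A \<inter> B) = (U \<inter> orbit_proj G -` A) \<inter> (U \<inter> orbit_proj G -` B)" for A B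
      by blast
    have 2: "U \<inter> orbit_proj G -` \<Union>\<K> = (\<Union>K\<in>\<K>. U \<inter> orbit_proj G -` K)" for \<K>
      by blast
    show ?thesis
      unfolding istopology_def
    proof (intro conjI allI impI)
      fix \<K> assume "\<forall>K\<in>\<K>. K \<subseteq> orbit_proj G ` U \<and> openin (top_of_set U) (U \<inter> orbit_proj G -` K)"
      then show "openin (top_of_set U) (U \<inter> orbit_proj G -` \<Union>\<K>)"
        unfolding 2 by (intro openin_Union) auto
    qed (unfold 1, blast+)
  qed
  then show ?thesis
    by (simp add: orbit_topology_def)
qed

lemma quotient_map_orbit_proj: "quotient_map (top_of_set U) (orbit_topology U G) (orbit_proj G)"
proof -
  have 1: "U \<inter> orbit_proj G -` (orbit_proj G ` U) = U"
    by blast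
  have "openin (orbit_topology U G) (orbit_proj G ` U)"
    unfolding openin_orbit_topology 1 by simp
  then have "topspace (orbit_topology U G) = orbit_proj G ` U"
    by (metis openin_orbit_topology openin_subset openin_topspace subset_antisym)
  moreover have "{x \<in> U. orbit_proj G x \<in> W} = U \<inter> orbit_proj G -` W" for W
    by blast
  ultimately show ?thesis
    unfolding quotient_map_def by (simp add: openin_orbit_topology)
qed

definition orbit_surface ::
  "(complex \<times> complex) set \<Rightarrow> (complex \<times> complex \<Rightarrow> complex \<times> complex) monoid
     \<Rightarrow> (complex \<times> complex) set complex_surface" where
  "orbit_surface U G =
     \<lparr>surface_top = orbit_topology U G,
      surface_atlas = {(orbit_proj G ` V, inv_into V (orbit_proj G)) | V.
                         open V \<and> V \<subseteq> U \<and> inj_on (orbit_proj G) V}\<rparr>"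


section \<open>Type I Inoue surfaces\<close>

definition upper_half_plane :: "complex set" where
  "upper_half_plane = {w. Im w > 0}"

text \<open>The three prescribed numbers are pairwise distinct for non-real \<open>\<beta>\<close>, so that
  comparing sets of roots of the cubic also accounts for multiplicities.\<close>

definition admissible :: "complex \<Rightarrow> bool" where
  "admissible \<beta> \<longleftrightarrow> \<beta> \<notin> \<real> \<and> cmod \<beta> < 1 \<and>
     (\<exists>\<theta>\<^sub>1 \<theta>\<^sub>2 :: int.
        {x. poly [:-1, of_int \<theta>\<^sub>1, - of_int \<theta>\<^sub>2, 1:] x = 0} =
        {complex_of_real (1 / (cmod \<beta>)\<^sup>2), \<beta>, cnj \<beta>})"

definition compatible :: "complex \<Rightarrow> real^3 \<Rightarrow> complex^3 \<Rightarrow> bool" where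
  "compatible \<beta> a b \<longleftrightarrow>
     (let a' = (\<chi> i. complex_of_real (a $ i));
          b' = (\<chi> i. cnj (b $ i));
          P = transpose (vector [a', b, b']) :: complex^3^3;
          d = vector [complex_of_real (1 / (cmod \<beta>)\<^sup>2), \<beta>, cnj \<beta>] :: complex^3;
          D = (\<chi> i j. if i = j then d $ i else 0) :: complex^3^3
      in distinct [a', b, b'] \<and> vec.independent {a', b, b'} \<and>
         (\<forall>i j. (P ** D ** matrix_inv P) $ i $ j \<in> \<int>))"

definition inoue_dilation :: "complex \<Rightarrow> complex \<times> complex \<Rightarrow> complex \<times> complex" where
  "inoue_dilation \<beta> =
     (\<lambda>(w, z) \<in> upper_half_plane \<times> UNIV. (complex_of_real (1 / (cmod \<beta>)\<^sup>2) * w, \<beta> * z))"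

definition inoue_translation ::
  "real^3 \<Rightarrow> complex^3 \<Rightarrow> 3 \<Rightarrow> complex \<times> complex \<Rightarrow> complex \<times> complex" where
  "inoue_translation a b i =
     (\<lambda>(w, z) \<in> upper_half_plane \<times> UNIV. (w + complex_of_real (a $ i), z + b $ i))"

definition inoue_group ::
  "complex \<Rightarrow> real^3 \<Rightarrow> complex^3 \<Rightarrow> (complex \<times> complex \<Rightarrow> complex \<times> complex) monoid" where
  "inoue_group \<beta> a b =
     subgroup_generated (BijGroup (upper_half_plane \<times> UNIV))
       (insert (inoue_dilation \<beta>) (range (inoue_translation a b)))"

text \<open>Since \<^const>\<open>subgroup_generated\<close> discards generators outside the ambient group, we record
  that none is discarded.\<close>

lemma inoue_dilation_in_Bij:
  assumes "\<beta> \<noteq> 0"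
  shows "inoue_dilation \<beta> \<in> carrier (BijGroup (upper_half_plane \<times> UNIV))"
proof -
  define r where "r = 1 / (cmod \<beta>)\<^sup>2"
  have r: "r > 0" using assms by (simp add: r_def)
  have "bij_betw (inoue_dilation \<beta>) (upper_half_plane \<times> UNIV) (upper_half_plane \<times> UNIV)"
  proof (rule bij_betw_byWitness[where f' = "\<lambda>(w, z). (w / complex_of_real r, z / \<beta>)"])
    show "\<forall>p \<in> upper_half_plane \<times> UNIV.
        (case inoue_dilation \<beta> p of (w, z) \<Rightarrow> (w / complex_of_real r, z / \<beta>)) = p"
      using r assms by (auto simp: inoue_dilation_def simp flip: r_def)
  qed (use r assms in \<open>auto simp: inoue_dilation_def upper_half_plane_def simp flip: r_def
        simp del: of_real_divide\<close>)
  then show ?thesis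
    by (simp add: BijGroup_def Bij_def inoue_dilation_def)
qed

lemma inoue_translation_in_Bij:
  "inoue_translation a b i \<in> carrier (BijGroup (upper_half_plane \<times> UNIV))"
proof -
  have "bij_betw (inoue_translation a b i) (upper_half_plane \<times> UNIV) (upper_half_plane \<times> UNIV)"
    by (rule bij_betw_byWitness[where f' = "\<lambda>(w, z). (w - complex_of_real (a $ i), z - b $ i)"])
       (auto simp: inoue_translation_def upper_half_plane_def)
  then show ?thesis
    by (simp add: BijGroup_def Bij_def inoue_translation_def)
qed

definition inoue_surface ::
  "complex \<Rightarrow> real^3 \<Rightarrow> complex^3 \<Rightarrow> (complex \<times> complex) set complex_surface" where
  "inoue_surface \<beta> a b = orbit_surface (upper_half_plane \<times> UNIV) (inoue_group \<beta> a b)"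

definition type_I_inoue_surface :: "(complex \<times> complex) set complex_surface \<Rightarrow> bool" where
  "type_I_inoue_surface S \<longleftrightarrow>
     (\<exists>\<beta> a b. admissible \<beta> \<and> compatible \<beta> a b \<and> S = inoue_surface \<beta> a b)"

end

theory Submission
  imports Defs "HOL-Complex_Analysis.Complex_Analysis"
begin

text \<open>A holomorphic map \<open>S \<rightarrow> S\<^sup>-\<close> from \<open>S = U/G\<close> to the conjugate surface lifts to a continuous
  \<open>F : U \<rightarrow> U\<close> with \<open>F \<circ> g = \<theta>(g) \<circ> F\<close> for a homomorphism \<open>\<theta>\<close> of \<open>G\<close>, and the conjugate of \<open>F\<close> is
  holomorphic. As \<open>H\<close> is a half plane, the first component of \<open>F\<close> does not depend on \<open>z\<close>.
  The integral matrix describing the action of the dilation on the lattice of translations has no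
  eigenvalue 1, which forces \<open>\<theta>\<close> to map translations to translations. The differences
  \<open>F\<^sub>2(w, z + u) - F\<^sub>2(w, z)\<close> are then invariant under a lattice of rank 3 in \<open>\<real> \<times> \<complex>\<close>, hence bounded in
  \<open>z\<close>, and by Liouville the conjugate of \<open>F\<^sub>2\<close> has the form \<open>c(w) z + d(w)\<close>. Here \<open>c\<close> is invariant
  under arbitrarily small translations, so it is constant, and equivariance under the dilation gives
  \<open>c \<beta> = c (cnj \<beta>)\<^sup>e\<close> for an integer \<open>e\<close>. If \<open>c\<close> is nonzero, comparing
  absolute values gives \<open>e = 1\<close>, contradicting that \<open>\<beta>\<close> is not real. If \<open>c\<close> is zero, then
  \<open>F\<close> is constant on the fibres over \<open>H\<close>, so the given map is not injective.\<close>

section \<open>Continuation of sections over convex sets\<close>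

text \<open>The distance from \<open>C\<close> to the complement of \<open>V\<close> is bounded
  below by some \<open>d\<close>; thickening \<open>C\<close> by the ball of radius \<open>d\<close>
  keeps it convex and inside \<open>V\<close>.\<close>

lemma convex_open_nhd:
  fixes C :: "'a::euclidean_space set"
  assumes "compact C" "convex C" "open V" "C \<subseteq> V"
  obtains W where "open W" "convex W" "C \<subseteq> W" "W \<subseteq> V"
proof -
  have "\<exists>d>0. \<forall>x\<in>C. \<forall>y\<in>- V. d \<le> dist x y"
    using assms by (intro separate_compact_closed) auto
  then obtain d where d: "d > 0" "\<And>x y. x \<in> C \<Longrightarrow> y \<in> - V \<Longrightarrow> d \<le> dist x y"
    by blast
  define W where "W = (\<Union>x\<in>C. \<Union>y\<in>ball 0 d. {x + y})"
  show thesis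
  proof
    show "open W" unfolding W_def by (rule open_sums) simp
    show "convex W" unfolding W_def by (rule convex_sums) (auto simp: assms)
    show "C \<subseteq> W"
      using d(1) unfolding W_def by force
    show "W \<subseteq> V"
      using d(2) unfolding W_def by (force simp: dist_norm)
  qed
qed

text \<open>\<open>L W k\<close> says that \<open>k\<close> is a section over \<open>W\<close>, and \<open>A y\<close> is the set of the values at \<open>y\<close>
  through which sections pass. As \<open>X\<close> is convex, sections are continued along the segments from \<open>x\<^sub>0\<close>;
  the domains of the continuations stay convex, so that any two of them overlap in a connected set.\<close>

lemma convex_continuation:
  fixes X :: "'a::euclidean_space set" and L :: "'a set \<Rightarrow> ('a \<Rightarrow> 'b) \<Rightarrow> bool"
  assumes X: "open X" "convex X" "x\<^sub>0 \<in> X"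
    and loc: "\<And>W F. open W \<Longrightarrow>
      (\<And>x. x \<in> W \<Longrightarrow> \<exists>V k. open V \<and> x \<in> V \<and> L V k \<and> (\<forall>y\<in>V \<inter> W. F y = k y)) \<Longrightarrow> L W F"
    and uniq: "\<And>W k k' x y. open W \<Longrightarrow> connected W \<Longrightarrow> W \<subseteq> X \<Longrightarrow> L W k \<Longrightarrow> L W k' \<Longrightarrow>
      x \<in> W \<Longrightarrow> k x = k' x \<Longrightarrow> y \<in> W \<Longrightarrow> k y = k' y"
    and ext: "\<And>x. x \<in> X \<Longrightarrow> \<exists>N. open N \<and> x \<in> N \<and> N \<subseteq> X \<and> (\<forall>y\<in>N. \<forall>a\<in>A y. \<exists>k. L N k \<and> k y = a)"
    and val: "\<And>W k y. L W k \<Longrightarrow> y \<in> W \<Longrightarrow> k y \<in> A y"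
    and a0: "a\<^sub>0 \<in> A x\<^sub>0"
  obtains F where "L X F" "F x\<^sub>0 = a\<^sub>0"
proof -
  \<comment> \<open>Locality, applied to a section that is its own local model, gives
    restriction.\<close>
  have restr: "L V k" if "L W k" "open W" "open V" "V \<subseteq> W" for V W k
    using loc[of V k] that by blast
  \<comment> \<open>The overlap of two convex domains is convex, hence connected, so agreement at
    one point spreads over all of it.\<close>
  have agree: "k y = k' y"
    if "L W k" "L W' k'" "open W" "open W'" "convex W" "convex W'" "W \<subseteq> X" "x \<in> W \<inter> W'" "k x = k' x"
      "y \<in> W \<inter> W'" for W W' k k' x y
  proof (rule uniq)
    show "L (W \<inter> W') k" "L (W \<inter> W') k'"
      using that restr[of _ _ "W \<inter> W'"] by blast+
    show "connected (W \<inter> W')"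
      using that by (intro convex_connected convex_Int)
  qed (use that in auto)
  \<comment> \<open>The domain contains the whole segment, and in particular
    \<open>x\<^sub>0\<close>, so that any two of these continuations can be compared at
    \<open>x\<^sub>0\<close>.\<close>
  define P where "P x \<longleftrightarrow> (\<exists>W k. open W \<and> convex W \<and> W \<subseteq> X \<and> closed_segment x\<^sub>0 x \<subseteq> W \<and>
      L W k \<and> k x\<^sub>0 = a\<^sub>0)" for x
  have all: "P x" if x: "x \<in> X" for x
  proof -
    define p where "p t = x\<^sub>0 + t *\<^sub>R (x - x\<^sub>0)" for t :: real
    have pX: "p t \<in> X" if "t \<in> {0..1}" for t
      using convexD_alt[OF X(2) X(3) x, of t] that by (simp add: p_def algebra_simps)
    have cp: "continuous_on UNIV p"
      unfolding p_def by (intro continuous_intros)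
    have seg: "y \<in> closed_segment x\<^sub>0 (p s) \<Longrightarrow> s \<ge> 0 \<Longrightarrow> \<exists>u\<in>{0..s}. y = p u" for y s
    proof -
      assume "y \<in> closed_segment x\<^sub>0 (p s)" and s: "s \<ge> 0"
      then obtain u where "0 \<le> u" "u \<le> 1" "y = p (u * s)"
        by (auto simp: in_segment p_def algebra_simps)
      with s show ?thesis by (intro bexI[of _ "u * s"]) (auto simp: mult_left_le_one_le)
    qed
    have seg': "p u \<in> closed_segment (p s) (p t)" if "s \<le> u" "u \<le> t" for s t u
    proof (cases "s = t")
      case False
      define v where "v = (u - s) / (t - s)"
      have v: "0 \<le> v" "v \<le> 1" "u = s + v * (t - s)"
        using that False by (auto simp: v_def field_simps)
      have "p u = (1 - v) *\<^sub>R p s + v *\<^sub>R p t"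
        unfolding v(3) p_def by (simp add: algebra_simps)
      with v(1,2) show ?thesis by (auto simp: in_segment)
    qed (use that in auto)
    have "P (p 1)"
    proof (rule connected_induction_simple[where S = "{0..1::real}" and P = "\<lambda>t. P (p t)" and a = 0])
      obtain N k where N: "open N" "x\<^sub>0 \<in> N" "N \<subseteq> X" "L N k" "k x\<^sub>0 = a\<^sub>0"
        using ext[OF X(3)] a0 by blast
      obtain e where "e > 0" "ball x\<^sub>0 e \<subseteq> N" using N by (meson openE)
      with N show "P (p 0)"
        unfolding P_def p_def by (intro exI[of _ "ball x\<^sub>0 e"] exI[of _ k])
          (auto intro: restr[of N])
    next
      fix t :: real assume t: "t \<in> {0..1}"
      obtain N where N: "open N" "p t \<in> N" "N \<subseteq> X"
          "\<And>y a. y \<in> N \<Longrightarrow> a \<in> A y \<Longrightarrow> \<exists>k. L N k \<and> k y = a"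
        using ext[OF pX[OF t]] by blast
      obtain e where e: "e > 0" "ball (p t) e \<subseteq> N" using N by (meson openE)
      define B where "B = ball (p t) e"
      have B: "open B" "convex B" "B \<subseteq> N" using e by (auto simp: B_def)
      \<comment> \<open>The statement is symmetric in \<open>s\<close> and \<open>s'\<close>: the
        truth value of \<open>P (p t)\<close> is locally constant in \<open>t\<close>, which
        suffices as the interval is connected and \<open>P (p 0)\<close> holds.\<close>
      have "P (p s')" if s: "s \<in> {0..1}" "s' \<in> {0..1}" "p s \<in> B" "p s' \<in> B" and Ps: "P (p s)" for s s'
      proof -
        obtain W k where W: "open W" "convex W" "W \<subseteq> X" "closed_segment x\<^sub>0 (p s) \<subseteq> W" "L W k"
            "k x\<^sub>0 = a\<^sub>0"
          using Ps unfolding P_def by blast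
        have ps: "p s \<in> W" using W(4) by auto
        obtain k' where k': "L N k'" "k' (p s) = k (p s)"
          using N(4)[of "p s" "k (p s)"] val[OF W(5) ps] s(3) B(3) by auto
        have LB: "L B k'" using k' restr B N(1) by blast
        have ag: "k y = k' y" if "y \<in> W \<inter> B" for y
          using agree[OF W(5) LB W(1) B(1) W(2) B(2) W(3), of "p s" y] ps s(3) k' that by auto
        define k'' where "k'' y = (if y \<in> W then k y else k' y)" for y
        have LU: "L (W \<union> B) k''"
        proof (rule loc)
          fix y assume "y \<in> W \<union> B"
          then show "\<exists>V k. open V \<and> y \<in> V \<and> L V k \<and> (\<forall>z\<in>V \<inter> (W \<union> B). k'' z = k z)"
          proof
            assume "y \<in> W"
            then show ?thesis using W by (intro exI[of _ W] exI[of _ k]) (auto simp: k''_def)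
          next
            assume "y \<in> B"
            then show ?thesis using B LB ag by (intro exI[of _ B] exI[of _ k']) (auto simp: k''_def)
          qed
        qed (use W B in auto)
        have "closed_segment x\<^sub>0 (p s') \<subseteq> W \<union> B"
        proof
          fix y assume "y \<in> closed_segment x\<^sub>0 (p s')"
          then obtain u where u: "u \<in> {0..s'}" "y = p u" using seg[of y s'] s by auto
          show "y \<in> W \<union> B"
          proof (cases "u \<le> s")
            case True
            have "p u \<in> closed_segment (p 0) (p s)" using seg'[of 0 u s] u True by auto
            then show ?thesis using W(4) u by (auto simp: p_def)
          next
            case False
            then have "p u \<in> closed_segment (p s) (p s')" using seg'[of s u s'] u by auto
            then show ?thesis using closed_segment_subset[OF s(3,4) B(2)] u by auto
          qed
        qed
        \<comment> \<open>\<open>W \<union> B\<close> need not be convex, so it is shrunk to a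
          convex neighbourhood of the new segment.\<close>
        then obtain W' where W': "open W'" "convex W'" "closed_segment x\<^sub>0 (p s') \<subseteq> W'" "W' \<subseteq> W \<union> B"
          using convex_open_nhd[of "closed_segment x\<^sub>0 (p s')" "W \<union> B"] W(1) B(1) by auto
        have "L W' k''" using restr[OF LU _ W'(1,4)] W(1) B(1) by auto
        moreover have "k'' x\<^sub>0 = a\<^sub>0" using W by (auto simp: k''_def)
        moreover have "W' \<subseteq> X" using W' W B N by blast
        ultimately show ?thesis unfolding P_def using W' by blast
      qed
      moreover have "openin (top_of_set {0..1}) ({0..1} \<inter> p -` B)"
        using continuous_openin_preimage_gen[of "{0..1}" p B] cp B(1) continuous_on_subset by blast
      moreover have "t \<in> {0..1} \<inter> p -` B" using t e by (auto simp: B_def)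
      ultimately show "\<exists>T. openin (top_of_set {0..1}) T \<and> t \<in> T \<and> (\<forall>x\<in>T. \<forall>y\<in>T. P (p x) \<longrightarrow> P (p y))"
        by (intro exI[of _ "{0..1} \<inter> p -` B"]) blast
    qed auto
    then show ?thesis by (simp add: p_def)
  qed
  have "\<exists>Wk. open (fst Wk) \<and> convex (fst Wk) \<and> fst Wk \<subseteq> X \<and> x\<^sub>0 \<in> fst Wk \<and> x \<in> fst Wk \<and>
      L (fst Wk) (snd Wk) \<and> snd Wk x\<^sub>0 = a\<^sub>0" if x: "x \<in> X" for x
  proof -
    obtain W k where "open W" "convex W" "W \<subseteq> X" "closed_segment x\<^sub>0 x \<subseteq> W" "L W k" "k x\<^sub>0 = a\<^sub>0"
      using all[OF x] unfolding P_def by blast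
    then show ?thesis by (intro exI[of _ "(W, k)"]) auto
  qed
  then obtain WK where WK: "\<And>x. x \<in> X \<Longrightarrow> open (fst (WK x)) \<and> convex (fst (WK x)) \<and> fst (WK x) \<subseteq> X \<and>
      x\<^sub>0 \<in> fst (WK x) \<and> x \<in> fst (WK x) \<and> L (fst (WK x)) (snd (WK x)) \<and> snd (WK x) x\<^sub>0 = a\<^sub>0"
    by metis
  \<comment> \<open>The chosen continuations all take the value \<open>a\<^sub>0\<close> at
    \<open>x\<^sub>0\<close>, so near \<open>x\<close> this diagonal choice coincides with the
    single section chosen for \<open>x\<close>.\<close>
  define F where "F x = snd (WK x) x" for x
  have "L X F"
  proof (rule loc)
    fix x assume x: "x \<in> X"
    have "F y = snd (WK x) y" if y: "y \<in> fst (WK x)" for y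
    proof -
      have "y \<in> X" using WK[OF x] y by blast
      then show ?thesis
        unfolding F_def using agree[of "fst (WK y)" "snd (WK y)" "fst (WK x)" "snd (WK x)" x\<^sub>0 y]
          WK[OF x] WK[of y] y by auto
    qed
    then show "\<exists>V k. open V \<and> x \<in> V \<and> L V k \<and> (\<forall>y\<in>V \<inter> X. F y = k y)"
      using WK[OF x] by blast
  qed (use X in auto)
  moreover have "F x\<^sub>0 = a\<^sub>0" using WK[OF X(3)] by (simp add: F_def)
  ultimately show thesis using that by blast
qed

section \<open>Lifting maps between orbit spaces\<close>

text \<open>The group laws are stated pointwise on \<open>U\<close>, because the values of the maps
  outside \<open>U\<close> are irrelevant. \<open>disc\<close> combines freeness with discontinuity:
  an element returning one point of \<open>V\<close> to \<open>V\<close> is already the identity on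
  \<open>U\<close>.\<close>

locale deck_action =
  fixes U :: "'p::euclidean_space set" and G :: "('p \<Rightarrow> 'p) monoid"
  assumes open_U: "open U"
    and maps: "\<And>g x. g \<in> carrier G \<Longrightarrow> x \<in> U \<Longrightarrow> g x \<in> U"
    and cont: "\<And>g. g \<in> carrier G \<Longrightarrow> continuous_on U g"
    and one: "\<exists>e\<in>carrier G. \<forall>x\<in>U. e x = x"
    and comp: "\<And>g h. g \<in> carrier G \<Longrightarrow> h \<in> carrier G \<Longrightarrow> \<exists>k\<in>carrier G. \<forall>x\<in>U. k x = g (h x)"
    and inv: "\<And>g. g \<in> carrier G \<Longrightarrow> \<exists>h\<in>carrier G. \<forall>x\<in>U. h (g x) = x \<and> g (h x) = x"
    and disc: "\<And>x. x \<in> U \<Longrightarrow> \<exists>V. open V \<and> x \<in> V \<and> V \<subseteq> U \<and>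
      (\<forall>g\<in>carrier G. \<forall>y\<in>V. g y \<in> V \<longrightarrow> (\<forall>z\<in>U. g z = z))"
begin

lemma orbit_proj_eq_iff:
  assumes "x \<in> U" "y \<in> U"
  shows "orbit_proj G x = orbit_proj G y \<longleftrightarrow> (\<exists>g\<in>carrier G. x = g y)"
proof
  assume "orbit_proj G x = orbit_proj G y"
  moreover have "x \<in> orbit_proj G x"
    using one assms unfolding orbit_def by (auto; metis)
  ultimately show "\<exists>g\<in>carrier G. x = g y" unfolding orbit_def by auto
next
  \<comment> \<open>One inclusion of orbits is enough: the other one follows by applying it to the
    inverse element.\<close>
  have sub: "orbit_proj G (g z) \<subseteq> orbit_proj G z" if g: "g \<in> carrier G" "z \<in> U" for g z
  proof
    fix u assume "u \<in> orbit_proj G (g z)"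
    then obtain h where h: "h \<in> carrier G" "u = h (g z)" unfolding orbit_def by auto
    obtain k where k: "k \<in> carrier G" "\<forall>x\<in>U. k x = h (g x)" using comp[OF h(1) g(1)] by blast
    then have "u = k z" using h g by simp
    with k show "u \<in> orbit_proj G z" unfolding orbit_def by blast
  qed
  assume "\<exists>g\<in>carrier G. x = g y"
  then obtain g where g: "g \<in> carrier G" "x = g y" by blast
  obtain h where "h \<in> carrier G" "\<forall>x\<in>U. h (g x) = x \<and> g (h x) = x" using inv[OF g(1)] by blast
  then show "orbit_proj G x = orbit_proj G y"
    using sub[OF g(1) assms(2)] sub[of h x] g assms by auto
qed

lemma disc_inj:
  assumes "x \<in> U"
  obtains V where "open V" "x \<in> V" "V \<subseteq> U" "inj_on (orbit_proj G) V"
proof -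
  obtain V where V: "open V" "x \<in> V" "V \<subseteq> U"
    "\<forall>g\<in>carrier G. \<forall>y\<in>V. g y \<in> V \<longrightarrow> (\<forall>z\<in>U. g z = z)"
    using disc[OF assms] by blast
  have "inj_on (orbit_proj G) V"
  proof (rule inj_onI)
    fix u v assume uv: "u \<in> V" "v \<in> V" "orbit_proj G u = orbit_proj G v"
    then obtain g where "g \<in> carrier G" "u = g v" using orbit_proj_eq_iff[of u v] V(3) by auto
    then show "u = v" using V uv by auto
  qed
  with V that show thesis by blast
qed

lemma topspace_orbit: "topspace (orbit_topology U G) = orbit_proj G ` U"
  using quotient_imp_surjective_map[OF quotient_map_orbit_proj[where U = U and G = G]] by simp

text \<open>The projection is open, since the saturation of \<open>V\<close> is the union of its
  preimages under the group elements.\<close>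

lemma openin_orbit_image:
  assumes "open V" "V \<subseteq> U"
  shows "openin (orbit_topology U G) (orbit_proj G ` V)"
proof -
  have "U \<inter> orbit_proj G -` (orbit_proj G ` V) = (\<Union>g\<in>carrier G. U \<inter> g -` V)"
  proof (rule Set.set_eqI, rule iffI)
    fix x assume "x \<in> U \<inter> orbit_proj G -` (orbit_proj G ` V)"
    then obtain v where v: "x \<in> U" "v \<in> V" "orbit_proj G v = orbit_proj G x" by auto
    then show "x \<in> (\<Union>g\<in>carrier G. U \<inter> g -` V)"
      using orbit_proj_eq_iff[of v x] assms by auto
  next
    fix x assume "x \<in> (\<Union>g\<in>carrier G. U \<inter> g -` V)"
    then obtain g where g: "g \<in> carrier G" "x \<in> U" "g x \<in> V" by auto
    then have "orbit_proj G (g x) = orbit_proj G x"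
      using orbit_proj_eq_iff[of "g x" x] assms by auto
    with g show "x \<in> U \<inter> orbit_proj G -` (orbit_proj G ` V)" by (auto intro: rev_image_eqI)
  qed
  moreover have "open (\<Union>g\<in>carrier G. U \<inter> g -` V)"
    using continuous_open_preimage[OF cont open_U assms(1)] by blast
  ultimately have "open (U \<inter> orbit_proj G -` (orbit_proj G ` V))" by simp
  then show ?thesis
    unfolding openin_orbit_topology using assms open_U by (auto simp: openin_open_eq)
qed

lemma continuous_map_orbit_proj: "continuous_map (top_of_set U) (orbit_topology U G) (orbit_proj G)"
  using quotient_imp_continuous_map[OF quotient_map_orbit_proj] .

text \<open>The set where the two lifts agree is open because the projection is locally injective,
  and closed because \<open>U\<close> is Hausdorff.\<close>

lemma lift_unique:
  fixes W :: "'a::topological_space set"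
  assumes W: "connected W"
    and k: "continuous_on W k" "k ` W \<subseteq> U" and k': "continuous_on W k'" "k' ` W \<subseteq> U"
    and eq: "\<And>y. y \<in> W \<Longrightarrow> orbit_proj G (k y) = orbit_proj G (k' y)"
    and x: "x \<in> W" "k x = k' x" and y: "y \<in> W"
  shows "k y = k' y"
proof (rule connected_induction_simple[OF W x(1) y, where P = "\<lambda>y. k y = k' y"])
  fix a assume a: "a \<in> W"
  show "\<exists>T. openin (top_of_set W) T \<and> a \<in> T \<and> (\<forall>x\<in>T. \<forall>y\<in>T. k x = k' x \<longrightarrow> k y = k' y)"
  proof (cases "k a = k' a")
    case True
    have "k a \<in> U" using a k by auto
    then obtain V where V: "open V" "k a \<in> V" "V \<subseteq> U" "inj_on (orbit_proj G) V"
      using disc_inj by metis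
    have "k y = k' y" if "y \<in> (W \<inter> k -` V) \<inter> (W \<inter> k' -` V)" for y
      using that eq[of y] V(4) unfolding inj_on_def by auto
    moreover have "openin (top_of_set W) ((W \<inter> k -` V) \<inter> (W \<inter> k' -` V))"
      using k k' V by (intro openin_Int continuous_openin_preimage_gen) auto
    ultimately show ?thesis using V True a by (intro exI[of _ "(W \<inter> k -` V) \<inter> (W \<inter> k' -` V)"]) auto
  next
    case False
    then obtain A B where AB: "open A" "open B" "k a \<in> A" "k' a \<in> B" "A \<inter> B = {}"
      using hausdorff by metis
    have "openin (top_of_set W) ((W \<inter> k -` A) \<inter> (W \<inter> k' -` B))"
      using k k' AB by (intro openin_Int continuous_openin_preimage_gen) auto
    with AB a show ?thesis by (intro exI[of _ "(W \<inter> k -` A) \<inter> (W \<inter> k' -` B)"]) auto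
  qed
qed (use x in auto)

text \<open>At one point the two values lie in the same orbit, which yields \<open>g\<close>; then
  \<open>k\<close> and \<open>g \<circ> k'\<close> are lifts of the same map agreeing at that
  point.\<close>

lemma lift_unique_upto_deck:
  fixes W :: "'a::topological_space set"
  assumes W: "connected W" "W \<noteq> {}"
    and k: "continuous_on W k" "k ` W \<subseteq> U" and k': "continuous_on W k'" "k' ` W \<subseteq> U"
    and eq: "\<And>y. y \<in> W \<Longrightarrow> orbit_proj G (k y) = orbit_proj G (k' y)"
  shows "\<exists>g\<in>carrier G. \<forall>y\<in>W. k y = g (k' y)"
proof -
  obtain x where x: "x \<in> W" using W by auto
  have "k x \<in> U" "k' x \<in> U" using x k k' by auto
  then obtain g where g: "g \<in> carrier G" "k x = g (k' x)"
    using orbit_proj_eq_iff[of "k x" "k' x"] eq[OF x] by auto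
  have "k y = g (k' y)" if "y \<in> W" for y
  proof (rule lift_unique[OF W(1) k, where k' = "\<lambda>y. g (k' y)"])
    show "continuous_on W (\<lambda>y. g (k' y))"
      using continuous_on_compose2[OF cont[OF g(1)] k'] .
    show "(\<lambda>y. g (k' y)) ` W \<subseteq> U" using maps[OF g(1)] k' by auto
    show "orbit_proj G (k y) = orbit_proj G (g (k' y))" if "y \<in> W" for y
    proof -
      have "k' y \<in> U" using that k' by auto
      then have "orbit_proj G (g (k' y)) = orbit_proj G (k' y)"
        using orbit_proj_eq_iff[of "g (k' y)" "k' y"] maps[OF g(1)] g(1) by auto
      then show ?thesis using eq[OF that] by simp
    qed
  qed (use g x that in auto)
  with g show ?thesis by blast
qed

text \<open>Where \<open>h\<close> takes values in the image of a set \<open>V\<close> of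
  injectivity, the inverse of the projection on \<open>V\<close> gives one lift, and the group moves
  it through any prescribed point of a fibre. One \<open>N\<close> serves all points and values, as
  \<open>convex_continuation\<close> requires.\<close>

lemma local_lift:
  fixes X :: "'a::topological_space set"
  assumes X: "open X" and h: "continuous_map (top_of_set X) (orbit_topology U G) h" and x: "x \<in> X"
  shows "\<exists>N. open N \<and> x \<in> N \<and> N \<subseteq> X \<and>
    (\<forall>y\<in>N. \<forall>a\<in>{a \<in> U. orbit_proj G a = h y}.
      \<exists>k. (continuous_on N k \<and> k ` N \<subseteq> U \<and> (\<forall>y\<in>N. orbit_proj G (k y) = h y)) \<and> k y = a)"
proof -
  let ?q = "orbit_proj G"
  have "h x \<in> ?q ` U"
    using h x topspace_orbit by (auto simp: continuous_map_def)
  then obtain b where b: "b \<in> U" "h x = ?q b" by auto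
  obtain V where V: "open V" "b \<in> V" "V \<subseteq> U" "inj_on ?q V" using disc_inj[OF b(1)] by metis
  have pre: "open (X \<inter> h -` (?q ` A))" if "open A" "A \<subseteq> U" for A
  proof -
    have "openin (top_of_set X) {x \<in> topspace (top_of_set X). h x \<in> ?q ` A}"
      using openin_continuous_map_preimage[OF h openin_orbit_image[OF that]] .
    moreover have "{x \<in> topspace (top_of_set X). h x \<in> ?q ` A} = X \<inter> h -` (?q ` A)" by auto
    ultimately show ?thesis using X by (simp add: openin_open_eq)
  qed
  define N where "N = X \<inter> h -` (?q ` V)"
  define s where "s y = inv_into V ?q (h y)" for y
  have s: "s y \<in> V" "?q (s y) = h y" if "y \<in> N" for y
  proof -
    have "h y \<in> ?q ` V" using that by (simp add: N_def)
    then show "s y \<in> V" "?q (s y) = h y"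
      unfolding s_def by (rule inv_into_into, rule f_inv_into_f)
  qed
  have s_eq: "s y = v" if "v \<in> V" "?q v = h y" for y v
    unfolding s_def using that inv_into_f_f[OF V(4) that(1)] by simp
  have cs: "continuous_on N s"
  proof -
    have "open (N \<inter> s -` B)" if "open B" for B
    proof -
      \<comment> \<open>Continuity of the local inverse is thereby reduced to openness of the
        projection.\<close>
      have "N \<inter> s -` B = X \<inter> h -` (?q ` (V \<inter> B))"
      proof (rule Set.set_eqI, rule iffI)
        fix y assume "y \<in> N \<inter> s -` B"
        then show "y \<in> X \<inter> h -` (?q ` (V \<inter> B))" using s[of y] by (auto simp: N_def intro: rev_image_eqI)
      next
        fix y assume y: "y \<in> X \<inter> h -` (?q ` (V \<inter> B))"
        then obtain v where v: "v \<in> V" "v \<in> B" "h y = ?q v" by auto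
        then show "y \<in> N \<inter> s -` B" using s_eq[of v y] y by (auto simp: N_def)
      qed
      with pre[of "V \<inter> B"] V that show ?thesis by auto
    qed
    moreover have "open N" unfolding N_def using pre V by auto
    ultimately show ?thesis by (subst continuous_on_open_vimage) (auto simp: Int_commute)
  qed
  have "\<exists>k. (continuous_on N k \<and> k ` N \<subseteq> U \<and> (\<forall>y\<in>N. ?q (k y) = h y)) \<and> k y = a"
    if y: "y \<in> N" and a: "a \<in> U" "?q a = h y" for y a
  proof -
    have sU: "s z \<in> U" if "z \<in> N" for z using s that V by auto
    obtain g where g: "g \<in> carrier G" "a = g (s y)"
      using orbit_proj_eq_iff[of a "s y"] a s[OF y] V by auto
    have "continuous_on N (\<lambda>z. g (s z))"
      by (rule continuous_on_compose2[OF cont[OF g(1)] cs]) (use sU in auto)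
    moreover have "?q (g (s z)) = h z" if "z \<in> N" for z
      using orbit_proj_eq_iff[of "g (s z)" "s z"] sU[OF that] maps[OF g(1)] g(1) s[OF that] by auto
    ultimately show ?thesis
      using g sU maps[OF g(1)] by (intro exI[of _ "\<lambda>z. g (s z)"]) auto
  qed
  moreover have "open N" "x \<in> N" "N \<subseteq> X"
    using pre[of V] V x b by (auto simp: N_def)
  ultimately show ?thesis by (intro exI[of _ N]) auto
qed

lemma lift_exists:
  fixes X :: "'a::euclidean_space set"
  assumes X: "open X" "convex X" and h: "continuous_map (top_of_set X) (orbit_topology U G) h"
  obtains F where "continuous_on X F" "F ` X \<subseteq> U" "\<And>x. x \<in> X \<Longrightarrow> orbit_proj G (F x) = h x"
proof (cases "X = {}")
  case False
  then obtain x0 where x0: "x0 \<in> X" by auto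
  define L where "L W k \<longleftrightarrow> continuous_on W k \<and> k ` W \<subseteq> U \<and> (\<forall>y\<in>W. orbit_proj G (k y) = h y)"
    for W k
  have "h x0 \<in> orbit_proj G ` U"
    using h x0 topspace_orbit by (auto simp: continuous_map_def)
  then obtain a0 where a0: "a0 \<in> {a \<in> U. orbit_proj G a = h x0}" by auto
  obtain F where "L X F"
  proof (rule convex_continuation[OF X x0, of L "\<lambda>y. {a \<in> U. orbit_proj G a = h y}" a0])
    fix W F assume W: "open W"
      and F: "\<And>x. x \<in> W \<Longrightarrow> \<exists>V k. open V \<and> x \<in> V \<and> L V k \<and> (\<forall>y\<in>V \<inter> W. F y = k y)"
    have "F x \<in> U \<and> orbit_proj G (F x) = h x \<and> isCont F x" if x: "x \<in> W" for x
    proof -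
      obtain V k where V: "open V" "x \<in> V" "L V k" "\<forall>y\<in>V \<inter> W. F y = k y" using F[OF x] by blast
      have "continuous_on (V \<inter> W) F"
        using V(3) V(4) unfolding L_def
        by (metis continuous_on_cong continuous_on_subset inf_le1)
      then have "isCont F x"
        by (rule continuous_on_interior) (use V x W in \<open>auto simp: interior_open\<close>)
      then show ?thesis using V x unfolding L_def by auto
    qed
    then show "L W F"
      unfolding L_def by (auto intro: continuous_at_imp_continuous_on)
  next
    fix W k k' x y assume "open W" "connected W" "W \<subseteq> X" "L W k" "L W k'" "x \<in> W" "k x = k' x" "y \<in> W"
    then show "k y = k' y"
      using lift_unique[of W k k' x y] unfolding L_def by auto
  next
    fix x assume "x \<in> X"
    from local_lift[OF X(1) h this]
    show "\<exists>N. open N \<and> x \<in> N \<and> N \<subseteq> X \<and>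
      (\<forall>y\<in>N. \<forall>a\<in>{a \<in> U. orbit_proj G a = h y}. \<exists>k. L N k \<and> k y = a)"
      unfolding L_def .
  next
    fix W k y assume "L W k" "y \<in> W"
    then show "k y \<in> {a \<in> U. orbit_proj G a = h y}" unfolding L_def by auto
  qed (use a0 in auto)
  then show thesis using that unfolding L_def by auto
qed (use that in auto)

text \<open>\<open>F\<close> is a lift of \<open>f\<close> composed with the projection. For
  \<open>g\<close> in the group, \<open>F \<circ> g\<close> lifts the same map, so it differs from
  \<open>F\<close> by a group element.\<close>

lemma orbit_map_lift:
  assumes "convex U" and f: "continuous_map (orbit_topology U G) (orbit_topology U G) f"
  obtains F where "continuous_on U F" "F ` U \<subseteq> U"
    "\<And>x. x \<in> U \<Longrightarrow> orbit_proj G (F x) = f (orbit_proj G x)"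
    "\<And>g. g \<in> carrier G \<Longrightarrow> \<exists>g'\<in>carrier G. \<forall>x\<in>U. F (g x) = g' (F x)"
proof (cases "U = {}")
  case True
  then show ?thesis using one by (intro that[of id]) auto
next
  case False
  have "continuous_map (top_of_set U) (orbit_topology U G) (f \<circ> orbit_proj G)"
    using continuous_map_compose[OF continuous_map_orbit_proj f] .
  then obtain F where F: "continuous_on U F" "F ` U \<subseteq> U"
    "\<And>x. x \<in> U \<Longrightarrow> orbit_proj G (F x) = f (orbit_proj G x)"
    using lift_exists[OF open_U assms(1)] by (metis comp_apply)
  have "\<exists>g'\<in>carrier G. \<forall>x\<in>U. F (g x) = g' (F x)" if g: "g \<in> carrier G" for g
  proof (rule lift_unique_upto_deck)
    show "continuous_on U (\<lambda>x. F (g x))"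
      by (rule continuous_on_compose2[OF F(1) cont[OF g]]) (use maps[OF g] in auto)
    show "(\<lambda>x. F (g x)) ` U \<subseteq> U" using F maps[OF g] by auto
    fix x assume x: "x \<in> U"
    have "orbit_proj G (g x) = orbit_proj G x"
      using orbit_proj_eq_iff[of "g x" x] maps[OF g x] x g by auto
    then show "orbit_proj G (F (g x)) = orbit_proj G (F x)"
      using F(3) maps[OF g x] x by simp
  qed (use assms False F convex_connected in auto)
  with F that show thesis by blast
qed

end

text \<open>The charts are local inverses of the projection, so near each point the conjugate of
  \<open>F\<close> is the expression of \<open>f\<close> in a chart of the source and a conjugated
  chart of the target.\<close>

lemma holomorphic_map_lift:
  assumes "deck_action U G"
    and f: "holomorphic_map (orbit_surface U G) (conjugate_surface (orbit_surface U G)) f"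
    and F: "continuous_on U F" "F ` U \<subseteq> U"
      "\<And>x. x \<in> U \<Longrightarrow> orbit_proj G (F x) = f (orbit_proj G x)"
  shows "holomorphic2_on (map_prod cnj cnj \<circ> F) U"
  unfolding holomorphic2_on_def
proof
  interpret deck_action U G by fact
  let ?q = "orbit_proj G"
  fix p assume p: "p \<in> U"
  obtain V where V: "open V" "p \<in> V" "V \<subseteq> U" "inj_on ?q V" using disc_inj[OF p] by metis
  have "F p \<in> U" using F p by auto
  then obtain V' where V': "open V'" "F p \<in> V'" "V' \<subseteq> U" "inj_on ?q V'" using disc_inj by metis
  let ?\<phi> = "inv_into V ?q" and ?\<psi> = "map_prod cnj cnj \<circ> inv_into V' ?q"
  have "(?q ` V, ?\<phi>) \<in> surface_atlas (orbit_surface U G)"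
    "(?q ` V', ?\<psi>) \<in> surface_atlas (conjugate_surface (orbit_surface U G))"
    using V V' unfolding orbit_surface_def conjugate_surface_def by (auto simp: image_iff)
  then have hol: "holomorphic2_on (?\<psi> \<circ> f \<circ> inv_into (?q ` V) ?\<phi>) (?\<phi> ` (?q ` V \<inter> f -` (?q ` V')))"
    using f unfolding holomorphic_map_def by blast
  \<comment> \<open>Inverting the chart recovers the projection on \<open>V\<close>.\<close>
  have inv_eq: "inv_into (?q ` V) ?\<phi> y = ?q y" if "y \<in> V" for y
  proof -
    have "?\<phi> (?q y) = y" using V(4) that by simp
    then show ?thesis using inv_into_f_f[OF inj_on_inv_into[of "?q ` V" ?q V], of "?q y"] that by auto
  qed
  have "f (?q p) \<in> ?q ` V'" using F(3)[OF p] V' by (metis image_eqI)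
  then have "?q p \<in> ?q ` V \<inter> f -` (?q ` V')" using V by auto
  then have "p \<in> ?\<phi> ` (?q ` V \<inter> f -` (?q ` V'))"
    using V by (intro image_eqI[of _ _ "?q p"]) auto
  then obtain D where D: "((?\<psi> \<circ> f \<circ> inv_into (?q ` V) ?\<phi>) has_derivative D) (at p)" "complex_homogeneous D"
    using hol unfolding holomorphic2_on_def by blast
  have "open (V \<inter> F -` V')"
    using continuous_open_preimage[OF continuous_on_subset[OF F(1) V(3)] V(1) V'(1)] .
  moreover have "(?\<psi> \<circ> f \<circ> inv_into (?q ` V) ?\<phi>) y = (map_prod cnj cnj \<circ> F) y"
    if y: "y \<in> V \<inter> F -` V'" for y
    using y inv_eq[of y] F(3)[of y, symmetric] V V' by auto
  ultimately have "((map_prod cnj cnj \<circ> F) has_derivative D) (at p)"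
    using has_derivative_transform_within_open[OF D(1), of "V \<inter> F -` V'"] V V' by auto
  with D(2) show "\<exists>D. ((map_prod cnj cnj \<circ> F) has_derivative D) (at p) \<and> complex_homogeneous D"
    by blast
qed

section \<open>Arithmetic of the lattice\<close>

text \<open>\<open>m\<close> is the integral matrix of the compatibility condition, with
  \<open>a\<close> and \<open>b\<close> among its eigenvectors. \<open>indep\<close> makes the pairs
  (\<open>a $ i\<close>, \<open>b $ i\<close>) a real basis of \<real> \<times> \<complex>, and
  \<open>fixed_0\<close> excludes the eigenvalue 1 on integral vectors.\<close>

locale inoue =
  fixes \<beta> :: complex and a :: "real^3" and b :: "complex^3" and r :: real
    and m :: "3 \<Rightarrow> 3 \<Rightarrow> int" and \<theta>\<^sub>1 \<theta>\<^sub>2 :: int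
  assumes beta_nonreal: "\<beta> \<notin> \<real>" and beta_less: "cmod \<beta> < 1"
    and r_def: "r = 1 / (cmod \<beta>)\<^sup>2"
    and beta_nz: "\<beta> \<noteq> 0" and r_gt1: "r > 1"
    and cubic_r: "r ^ 3 - of_int \<theta>\<^sub>2 * r ^ 2 + of_int \<theta>\<^sub>1 * r - 1 = 0"
    and cubic_beta: "\<beta> ^ 3 - of_int \<theta>\<^sub>2 * \<beta> ^ 2 + of_int \<theta>\<^sub>1 * \<beta> - 1 = 0"
    and row_a: "\<And>i. r * a $ i = (\<Sum>j\<in>UNIV. of_int (m i j) * a $ j)"
    and row_b: "\<And>i. \<beta> * b $ i = (\<Sum>j\<in>UNIV. of_int (m i j) * b $ j)"
    and indep: "\<And>x :: real^3. (\<Sum>i\<in>UNIV. x $ i * a $ i) = 0 \<Longrightarrow>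
       (\<Sum>i\<in>UNIV. complex_of_real (x $ i) * b $ i) = 0 \<Longrightarrow> x = 0"
    and fixed_0: "\<And>(k :: 3 \<Rightarrow> int) i. (\<And>i. (\<Sum>j\<in>UNIV. m i j * k j) = k i) \<Longrightarrow> k i = 0"

lemma inoue_arithmetic:
  assumes adm: "admissible \<beta>" and com: "compatible \<beta> a b" and r: "r = 1 / (cmod \<beta>)\<^sup>2"
  obtains m \<theta>\<^sub>1 \<theta>\<^sub>2 where "inoue \<beta> a b r m \<theta>\<^sub>1 \<theta>\<^sub>2"
proof -
  obtain \<theta>\<^sub>1 \<theta>\<^sub>2 :: int where
    roots: "{x. poly [:-1, of_int \<theta>\<^sub>1, - of_int \<theta>\<^sub>2, 1:] x = 0} = {complex_of_real r, \<beta>, cnj \<beta>}"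
    and \<beta>: "\<beta> \<notin> \<real>" "cmod \<beta> < 1"
    using adm unfolding admissible_def r by blast
  have poly3: "poly [:-1, of_int \<theta>\<^sub>1, - of_int \<theta>\<^sub>2, 1:] x =
      x ^ 3 - of_int \<theta>\<^sub>2 * x ^ 2 + of_int \<theta>\<^sub>1 * x - 1" for x :: complex
    by (simp add: algebra_simps power2_eq_square power3_eq_cube)
  have \<beta>0: "\<beta> \<noteq> 0" using \<beta>(1) by auto
  have r1: "r > 1"
    unfolding r using \<beta> \<beta>0 by (simp add: power_less_one_iff)
  have cub: "\<beta> ^ 3 - of_int \<theta>\<^sub>2 * \<beta> ^ 2 + of_int \<theta>\<^sub>1 * \<beta> - 1 = 0"
    "complex_of_real r ^ 3 - of_int \<theta>\<^sub>2 * complex_of_real r ^ 2 + of_int \<theta>\<^sub>1 * complex_of_real r - 1 = 0"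
  proof -
    have "\<beta> \<in> {x. poly [:-1, of_int \<theta>\<^sub>1, - of_int \<theta>\<^sub>2, 1:] x = 0}"
      "complex_of_real r \<in> {x. poly [:-1, of_int \<theta>\<^sub>1, - of_int \<theta>\<^sub>2, 1:] x = 0}"
      unfolding roots by auto
    then show "\<beta> ^ 3 - of_int \<theta>\<^sub>2 * \<beta> ^ 2 + of_int \<theta>\<^sub>1 * \<beta> - 1 = 0"
      "complex_of_real r ^ 3 - of_int \<theta>\<^sub>2 * complex_of_real r ^ 2 + of_int \<theta>\<^sub>1 * complex_of_real r - 1 = 0"
      unfolding mem_Collect_eq poly3 .
  qed
  have "complex_of_real (r ^ 3 - of_int \<theta>\<^sub>2 * r ^ 2 + of_int \<theta>\<^sub>1 * r - 1) = 0"
    using cub(2) by simp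
  then have cubr: "r ^ 3 - of_int \<theta>\<^sub>2 * r ^ 2 + of_int \<theta>\<^sub>1 * r - 1 = 0"
    by (simp only: of_real_eq_0_iff)
  define a' where "a' = (\<chi> i. complex_of_real (a $ i))"
  define b' where "b' = (\<chi> i. cnj (b $ i))"
  define P where "P = (transpose (vector [a', b, b']) :: complex^3^3)"
  define d where "d = (vector [complex_of_real r, \<beta>, cnj \<beta>] :: complex^3)"
  define D where "D = ((\<chi> i j. if i = j then d $ i else 0) :: complex^3^3)"
  have ind: "distinct [a', b, b']" "vec.independent {a', b, b'}"
    and int: "\<And>i j. (P ** D ** matrix_inv P) $ i $ j \<in> \<int>"
    using com unfolding compatible_def Let_def a'_def b'_def P_def d_def D_def r by auto
  have P_nth: "P $ i $ 1 = a' $ i" "P $ i $ 2 = b $ i" "P $ i $ 3 = b' $ i" for i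
    unfolding P_def transpose_def by (simp_all add: vector_3)
  have "\<forall>i. c i = 0" if "(\<Sum>i\<in>UNIV. c i *s column i P) = 0" for c
  proof -
    have col: "column 1 P = a'" "column 2 P = b" "column 3 P = b'"
      by (simp_all add: column_def P_nth vec_eq_iff)
    \<comment> \<open>As the columns are distinct, coefficients indexed by positions become
      coefficients indexed by vectors, and independence of the set applies.\<close>
    define u where "u v = (if v = a' then c 1 else if v = b then c 2 else c 3)" for v
    have "(\<Sum>v\<in>{a', b, b'}. u v *s v) = 0"
      using that ind(1) by (auto simp: sum_3 col u_def add.assoc)
    then have "u a' = 0" "u b = 0" "u b' = 0"
      using ind(2) vec.independentD[of "{a', b, b'}" "{a', b, b'}" u] by auto
    then show ?thesis using ind(1) by (auto simp: u_def forall_3)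
  qed
  then obtain B where "B ** P = mat 1"
    using matrix_left_invertible_independent_columns[of P] by blast
  then have "invertible P"
    unfolding invertible_def using matrix_left_right_inverse by blast
  then have inv: "P ** matrix_inv P = mat 1" "matrix_inv P ** P = mat 1"
    unfolding invertible_def matrix_inv_def by (metis (mono_tags, lifting) someI_ex)+
  define Q where "Q = P ** D ** matrix_inv P"
  have QP: "Q ** P = P ** D"
    unfolding Q_def by (simp add: matrix_mul_assoc[symmetric] inv)
  define m where "m i j = \<lfloor>Re (Q $ i $ j)\<rfloor>" for i j
  have m: "Q $ i $ j = of_int (m i j)" for i j
    using int[of i j] unfolding Q_def[symmetric] m_def by (auto elim!: Ints_cases)
  have D_nth: "(P ** D) $ i $ l = P $ i $ l * d $ l" for i l
    unfolding matrix_matrix_mult_def D_def by (simp add: if_distrib cong: if_cong)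
  have rows: "(\<Sum>j\<in>UNIV. of_int (m i j) * P $ j $ l) = P $ i $ l * d $ l" for i l
  proof -
    have "(Q ** P) $ i $ l = (\<Sum>j\<in>UNIV. of_int (m i j) * P $ j $ l)"
      unfolding matrix_matrix_mult_def by (simp add: m)
    then show ?thesis using QP D_nth by simp
  qed
  have d_nth: "d $ 1 = complex_of_real r" "d $ 2 = \<beta>" "d $ 3 = cnj \<beta>"
    unfolding d_def by (simp_all add: vector_3)
  have row_a: "r * a $ i = (\<Sum>j\<in>UNIV. of_int (m i j) * a $ j)" for i
  proof -
    have "complex_of_real (\<Sum>j\<in>UNIV. of_int (m i j) * a $ j) = complex_of_real (r * a $ i)"
      using rows[of i 1] by (simp add: P_nth d_nth a'_def mult.commute)
    then show ?thesis by (simp only: of_real_eq_iff)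
  qed
  have row_b: "\<beta> * b $ i = (\<Sum>j\<in>UNIV. of_int (m i j) * b $ j)" for i
    using rows[of i 2] by (simp add: P_nth d_nth mult.commute)
  have indep: "x = 0" if "(\<Sum>i\<in>UNIV. x $ i * a $ i) = 0"
    "(\<Sum>i\<in>UNIV. complex_of_real (x $ i) * b $ i) = 0" for x :: "real^3"
  proof -
    define y where "y = (\<chi> i. complex_of_real (x $ i))"
    have 1: "(\<Sum>i\<in>UNIV. complex_of_real (x $ i) * a' $ i) = 0"
    proof -
      have "(\<Sum>i\<in>UNIV. complex_of_real (x $ i) * a' $ i) = complex_of_real (\<Sum>i\<in>UNIV. x $ i * a $ i)"
        by (simp add: a'_def)
      then show ?thesis using that by simp
    qed
    \<comment> \<open>As \<open>x\<close> is real, this relation is the conjugate of the one for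
      \<open>b\<close>.\<close>
    have 2: "(\<Sum>i\<in>UNIV. complex_of_real (x $ i) * b' $ i) = 0"
    proof -
      have "(\<Sum>i\<in>UNIV. complex_of_real (x $ i) * b' $ i) = cnj (\<Sum>i\<in>UNIV. complex_of_real (x $ i) * b $ i)"
        by (simp add: b'_def)
      then show ?thesis using that by simp
    qed
    have "y v* P = 0"
      using 1 2 that(2) by (simp add: vec_eq_iff vector_matrix_mult_def forall_3 P_nth y_def mult.commute)
    then have "(y v* P) v* matrix_inv P = 0" by (simp add: vector_matrix_mult_def vec_eq_iff)
    then have "y = 0" by (simp add: vector_matrix_mul_assoc inv)
    then show "x = 0" by (simp add: y_def vec_eq_iff)
  qed
  have fixed: "k i = 0" if k: "\<And>i. (\<Sum>j\<in>UNIV. m i j * k j) = k i" for k :: "3 \<Rightarrow> int" and i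
  proof -
    \<comment> \<open>In the basis of eigenvectors a fixed vector of \<open>Q\<close> is fixed by
      the diagonal matrix \<open>D\<close>, none of whose diagonal entries is 1.\<close>
    define y :: "complex^3" where "y = (\<chi> i. of_int (k i))"
    have "Q *v y = y"
    proof -
      have "(Q *v y) $ i = y $ i" for i
      proof -
        have "(Q *v y) $ i = of_int (\<Sum>j\<in>UNIV. m i j * k j)"
          by (simp add: matrix_vector_mult_def m y_def)
        then show ?thesis by (simp only: k y_def vec_lambda_beta)
      qed
      then show ?thesis by (simp add: vec_eq_iff)
    qed
    then have "matrix_inv P *v (Q *v y) = matrix_inv P *v y" by simp
    then have *: "D *v (matrix_inv P *v y) = matrix_inv P *v y"
      unfolding Q_def by (simp add: matrix_vector_mul_assoc matrix_mul_assoc inv)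
    have "(matrix_inv P *v y) $ l = 0" for l
    proof -
      have "(D *v z) $ l = d $ l * z $ l" for z
        by (simp add: matrix_vector_mult_def D_def if_distrib[of "\<lambda>x. x * _"] cong: if_cong)
      moreover have "\<beta> \<noteq> 1" "cnj \<beta> \<noteq> 1" "complex_of_real r \<noteq> 1"
        using \<beta> r1 by (auto simp: complex_cnj_cancel_iff[of _ 1, simplified])
      then have "\<forall>l. d $ l \<noteq> 1" by (simp add: forall_3 d_nth)
      then have "d $ l \<noteq> 1" by blast
      ultimately show ?thesis using * by (metis mult_cancel_right1 mult.commute)
    qed
    then have "matrix_inv P *v y = 0" by (simp add: vec_eq_iff)
    then have "P *v (matrix_inv P *v y) = 0" by simp
    then have "y = 0" by (simp add: matrix_vector_mul_assoc inv)
    then show "k i = 0" by (simp add: y_def vec_eq_iff)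
  qed
  have "inoue \<beta> a b r m \<theta>\<^sub>1 \<theta>\<^sub>2"
    by standard (fact \<beta> r \<beta>0 r1 cubr cub(1) row_a row_b | erule (1) indep | erule fixed)+
  with that show thesis .
qed

section \<open>The action of the group of an Inoue surface\<close>

lemma BijGroup_maps: "g \<in> carrier (BijGroup S) \<Longrightarrow> p \<in> S \<Longrightarrow> g p \<in> S"
  using Bij_imp_funcset[of g S] unfolding BijGroup_def partial_object.simps by blast

lemma BijGroup_mult: "g \<in> carrier (BijGroup S) \<Longrightarrow> h \<in> carrier (BijGroup S) \<Longrightarrow> p \<in> S \<Longrightarrow>
    (g \<otimes>\<^bsub>BijGroup S\<^esub> h) p = g (h p)"
  by (simp add: BijGroup_def compose_eq)

lemma BijGroup_one: "p \<in> S \<Longrightarrow> \<one>\<^bsub>BijGroup S\<^esub> p = p"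
  by (simp add: BijGroup_def)

lemma BijGroup_inv:
  assumes "g \<in> carrier (BijGroup S)" "p \<in> S"
  shows "(inv\<^bsub>BijGroup S\<^esub> g) (g p) = p" "g ((inv\<^bsub>BijGroup S\<^esub> g) p) = p"
proof -
  interpret B: group "BijGroup S" by (rule group_BijGroup)
  show "(inv\<^bsub>BijGroup S\<^esub> g) (g p) = p" "g ((inv\<^bsub>BijGroup S\<^esub> g) p) = p"
    using BijGroup_mult[of "inv\<^bsub>BijGroup S\<^esub> g" S g p] BijGroup_mult[of g S "inv\<^bsub>BijGroup S\<^esub> g" p]
      assms BijGroup_one B.l_inv B.r_inv B.inv_closed by metis+
qed

context inoue
begin

text \<open>The translation parts of the group lie in \<real> \<times> \<complex>;
  \<open>ell\<close> is the linear isomorphism given by coordinates with respect to the generating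
  translations.\<close>

definition ell :: "real^3 \<Rightarrow> real \<times> complex" where
  "ell x = (\<Sum>i\<in>UNIV. x $ i * a $ i, \<Sum>i\<in>UNIV. complex_of_real (x $ i) * b $ i)"

definition Lat :: "(real \<times> complex) set" where
  "Lat = ell ` {x. \<forall>i. x $ i \<in> \<int>}"

text \<open>The effect on translation vectors of conjugation by the \<open>k\<close>-th power of the
  dilation.\<close>

definition dilate :: "int \<Rightarrow> real \<times> complex \<Rightarrow> real \<times> complex" where
  "dilate k v = (r powi k * fst v, \<beta> powi k * snd v)"

definition act :: "int \<Rightarrow> real \<times> complex \<Rightarrow> complex \<times> complex \<Rightarrow> complex \<times> complex" where
  "act k v p = (complex_of_real (r powi k) * fst p + complex_of_real (fst v), \<beta> powi k * snd p + snd v)"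

abbreviation U :: "(complex \<times> complex) set" where
  "U \<equiv> upper_half_plane \<times> UNIV"

abbreviation G :: "(complex \<times> complex \<Rightarrow> complex \<times> complex) monoid" where
  "G \<equiv> inoue_group \<beta> a b"

section \<open>The lattice of translations and its dilation\<close>

lemma r_pos: "r > 0" and r_nz: "r \<noteq> 0"
  using r_gt1 by auto

lemma linear_ell: "linear ell"
proof (rule linearI)
  show "ell (x + y) = ell x + ell y" for x y
    by (simp add: ell_def algebra_simps sum.distrib)
  show "ell (c *\<^sub>R x) = c *\<^sub>R ell x" for c x
    by (simp add: ell_def sum_distrib_left scaleR_conv_of_real[where 'a = complex] mult.assoc)
qed

lemma inj_ell: "inj ell"
proof -
  have "x = 0" if "ell x = 0" for x
    using that indep[of x] by (simp add: ell_def zero_prod_def)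
  then show ?thesis using linear_injective_0[OF linear_ell] by blast
qed

lemma surj_ell: "surj ell"
proof -
  have "dim (range ell) = DIM(real \<times> complex)"
    using dim_image_eq[OF linear_ell, of UNIV] inj_ell by simp
  then have "span (range ell) = UNIV" using dim_eq_full by blast
  then show ?thesis
    using linear_subspace_image[OF linear_ell subspace_UNIV] span_eq_iff[of "range ell"] by simp
qed

text \<open>The rows of \<open>m\<close> express the dilated generators, so coordinate vectors are
  transformed by the transpose of \<open>m\<close>.\<close>

lemma ell_scale: "ell (\<chi> j. \<Sum>i\<in>UNIV. of_int (m i j) * x $ i) = (r * fst (ell x), \<beta> * snd (ell x))"
proof -
  have "(\<Sum>j\<in>UNIV. (\<Sum>i\<in>UNIV. of_int (m i j) * x $ i) * a $ j) = (\<Sum>i\<in>UNIV. x $ i * (r * a $ i))"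
    unfolding row_a sum_distrib_left sum_distrib_right by (subst sum.swap) (simp add: mult_ac)
  moreover have "(\<Sum>j\<in>UNIV. complex_of_real (\<Sum>i\<in>UNIV. of_int (m i j) * x $ i) * b $ j) =
      (\<Sum>i\<in>UNIV. complex_of_real (x $ i) * (\<beta> * b $ i))"
    unfolding row_b sum_distrib_left sum_distrib_right of_real_sum
    by (subst sum.swap) (simp add: mult_ac)
  ultimately show ?thesis
    by (simp add: ell_def sum_distrib_left mult_ac)
qed

lemma Lat_add: "u \<in> Lat \<Longrightarrow> v \<in> Lat \<Longrightarrow> u + v \<in> Lat"
  unfolding Lat_def by (auto simp: linear_add[OF linear_ell, symmetric] intro!: imageI)

lemma Lat_scaleR: "v \<in> Lat \<Longrightarrow> n \<in> \<int> \<Longrightarrow> n *\<^sub>R v \<in> Lat"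
  unfolding Lat_def by (auto simp: linear_scale[OF linear_ell, symmetric] intro!: imageI)

lemma Lat_minus: "v \<in> Lat \<Longrightarrow> - v \<in> Lat"
  using Lat_scaleR[of v "-1"] by simp

lemma Lat_0: "0 \<in> Lat"
  unfolding Lat_def using linear_0[OF linear_ell] by (auto intro!: image_eqI[of _ _ 0])

lemma Lat_dilate_1: "v \<in> Lat \<Longrightarrow> dilate 1 v \<in> Lat"
  unfolding Lat_def dilate_def by (auto simp: ell_scale[symmetric] intro!: imageI Ints_sum Ints_mult)

text \<open>By the cubic equation, the inverse of the dilation acts on the lattice as
  an integral polynomial in the dilation.\<close>

lemma Lat_dilate_minus_1:
  assumes "v \<in> Lat" shows "dilate (-1) v \<in> Lat"
proof -
  have 1: "inverse r = r\<^sup>2 - of_int \<theta>\<^sub>2 * r + of_int \<theta>\<^sub>1"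
    using cubic_r r_nz by (simp add: field_simps power2_eq_square power3_eq_cube)
  have 2: "inverse \<beta> = \<beta>\<^sup>2 - of_int \<theta>\<^sub>2 * \<beta> + of_int \<theta>\<^sub>1"
    using cubic_beta beta_nz by (simp add: field_simps power2_eq_square power3_eq_cube)
  have eq: "dilate (-1) v = dilate 1 (dilate 1 v) + (- of_int \<theta>\<^sub>2) *\<^sub>R dilate 1 v + of_int \<theta>\<^sub>1 *\<^sub>R v"
    unfolding dilate_def
    by (simp add: power_int_minus 1 2 algebra_simps power2_eq_square scaleR_conv_of_real prod_eq_iff)
  show ?thesis
    unfolding eq using assms by (intro Lat_add Lat_scaleR Lat_dilate_1) auto
qed

lemma dilate_add: "dilate (k + l) v = dilate k (dilate l v)"
  using r_nz beta_nz by (simp add: dilate_def power_int_add mult_ac)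

lemma Lat_dilate: "v \<in> Lat \<Longrightarrow> dilate k v \<in> Lat"
proof (induction k rule: int_induct[where k = 0])
  case base
  then show ?case by (simp add: dilate_def)
next
  case (step1 i)
  then show ?case using Lat_dilate_1 dilate_add[of 1 i v] by (simp add: add.commute)
next
  case (step2 i)
  then show ?case using Lat_dilate_minus_1 dilate_add[of "-1" i v] by simp
qed

section \<open>The group as affine maps with translation parts in the lattice\<close>

lemma act_act: "act k u (act l v p) = act (k + l) (u + dilate k v) p"
  using r_nz beta_nz by (simp add: act_def dilate_def power_int_add algebra_simps)

lemma act_0: "act 0 0 p = p"
  by (simp add: act_def)

lemma act_in_U: "p \<in> U \<Longrightarrow> act k v p \<in> U"
  using r_pos by (auto simp: act_def upper_half_plane_def zero_less_power_int
      simp del: of_real_power_int)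

lemma open_U: "open U"
  unfolding upper_half_plane_def by (intro open_Times open_halfspace_Im_gt open_UNIV)

lemma convex_U: "convex U"
  unfolding upper_half_plane_def by (intro convex_Times convex_halfspace_Im_gt convex_UNIV)

text \<open>A subgroup containing the generators, which gives every element of \<open>G\<close> the
  explicit form \<open>act k v\<close>.\<close>

definition lattice_affine :: "(complex \<times> complex \<Rightarrow> complex \<times> complex) set" where
  "lattice_affine = {g \<in> carrier (BijGroup U). \<exists>k. \<exists>v\<in>Lat. \<forall>p\<in>U. g p = act k v p}"

lemma subgroup_lattice_affine: "subgroup lattice_affine (BijGroup U)"
proof -
  interpret B: group "BijGroup U" by (rule group_BijGroup)
  show ?thesis
  proof
    show "lattice_affine \<subseteq> carrier (BijGroup U)" by (auto simp: lattice_affine_def)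
    show "\<one>\<^bsub>BijGroup U\<^esub> \<in> lattice_affine"
      unfolding lattice_affine_def using BijGroup_one[where S = U] act_0 Lat_0 by (auto intro!: exI[of _ 0] bexI[of _ 0])
  next
    fix g h assume "g \<in> lattice_affine" "h \<in> lattice_affine"
    then obtain k u l v where *: "g \<in> carrier (BijGroup U)" "u \<in> Lat" "\<forall>p\<in>U. g p = act k u p"
      "h \<in> carrier (BijGroup U)" "v \<in> Lat" "\<forall>p\<in>U. h p = act l v p"
      unfolding lattice_affine_def by blast
    have "(g \<otimes>\<^bsub>BijGroup U\<^esub> h) p = act (k + l) (u + dilate k v) p" if "p \<in> U" for p
      using BijGroup_mult[where S = U, OF *(1,4) that] * act_act act_in_U that by metis
    then show "g \<otimes>\<^bsub>BijGroup U\<^esub> h \<in> lattice_affine"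
      unfolding lattice_affine_def using * Lat_add Lat_dilate by blast
  next
    fix g assume "g \<in> lattice_affine"
    then obtain k u where *: "g \<in> carrier (BijGroup U)" "u \<in> Lat" "\<forall>p\<in>U. g p = act k u p"
      unfolding lattice_affine_def by blast
    let ?h = "inv\<^bsub>BijGroup U\<^esub> g"
    have "?h p = act (-k) (- dilate (-k) u) p" if p: "p \<in> U" for p
    proof -
      have "?h p \<in> U" using BijGroup_maps[where S = U] B.inv_closed * p by blast
      then have "act k u (?h p) = p" using BijGroup_inv(2)[where S = U, OF *(1) p] * by simp
      then have "act (-k) (- dilate (-k) u) p = act (-k) (- dilate (-k) u) (act k u (?h p))" by simp
      also have "\<dots> = ?h p" by (simp add: act_act act_0)
      finally show ?thesis by simp
    qed
    moreover have "- dilate (-k) u \<in> Lat" using * Lat_dilate Lat_minus by blast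
    ultimately show "?h \<in> lattice_affine" unfolding lattice_affine_def using * B.inv_closed by blast
  qed
qed

lemma dilation_act: "p \<in> U \<Longrightarrow> inoue_dilation \<beta> p = act 1 0 p"
  by (auto simp: inoue_dilation_def act_def simp flip: r_def simp del: of_real_divide)

lemma translation_act: "p \<in> U \<Longrightarrow> inoue_translation a b i p = act 0 (ell (axis i 1)) p"
  by (auto simp: inoue_translation_def act_def ell_def axis_def if_distrib[of complex_of_real]
      if_distrib[of "\<lambda>x. x * _"] cong: if_cong)

lemma dilation_in_G: "inoue_dilation \<beta> \<in> carrier G"
  and translation_in_G: "inoue_translation a b i \<in> carrier G"
  unfolding inoue_group_def carrier_subgroup_generated
  using inoue_dilation_in_Bij[OF beta_nz] inoue_translation_in_Bij[of a b]
  by (auto intro!: generate.incl)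

lemma G_subset_lattice_affine: "carrier G \<subseteq> lattice_affine"
proof -
  have "ell (axis i 1) \<in> Lat" for i
    unfolding Lat_def by (auto simp: axis_def)
  then have "inoue_translation a b i \<in> lattice_affine" for i
    unfolding lattice_affine_def using inoue_translation_in_Bij translation_act by blast
  moreover have "inoue_dilation \<beta> \<in> lattice_affine"
    unfolding lattice_affine_def using inoue_dilation_in_Bij[OF beta_nz] dilation_act Lat_0 by blast
  ultimately show ?thesis
    unfolding inoue_group_def carrier_subgroup_generated
    by (intro group.generate_subgroup_incl[OF group_BijGroup _ subgroup_lattice_affine]) auto
qed

lemma G_act:
  assumes "g \<in> carrier G"
  obtains k v where "v \<in> Lat" "\<And>p. p \<in> U \<Longrightarrow> g p = act k v p"
  using G_subset_lattice_affine assms unfolding lattice_affine_def by blast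

text \<open>An injective linear map is bounded below, so a short lattice vector has integral
  coordinates of absolute value less than 1.\<close>

lemma Lat_discrete:
  obtains \<epsilon> where "\<epsilon> > 0" "\<And>v. v \<in> Lat \<Longrightarrow> norm v < \<epsilon> \<Longrightarrow> v = 0"
proof -
  obtain B where B: "B > 0" "\<And>x. B * norm x \<le> norm (ell x)"
    using linear_inj_bounded_below_pos[OF linear_ell inj_ell] by blast
  have "v = 0" if v: "v \<in> Lat" "norm v < B" for v
  proof -
    obtain x :: "real^3" where x: "v = ell x" "\<forall>i. x $ i \<in> \<int>" using v unfolding Lat_def by auto
    have "B * norm x < B" using B(2)[of x] v x by simp
    then have n1: "norm x < 1" using B(1) by simp
    have "x $ i = 0" for i
    proof -
      have "\<bar>x $ i\<bar> < 1" using component_le_norm_cart[of x i] n1 by simp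
      moreover obtain n where "x $ i = of_int n" using x by (metis Ints_cases)
      ultimately show ?thesis by simp
    qed
    then have "x = 0" by (simp add: vec_eq_iff)
    then show ?thesis using x linear_0[OF linear_ell] by simp
  qed
  with B that show thesis by blast
qed

text \<open>A thin horizontal strip in the first variable excludes nonzero exponents, which rescale
  the imaginary part by at least a factor \<open>r\<close> up or down; a small ball then excludes
  nonzero lattice translations.\<close>

lemma act_disc:
  assumes "p \<in> U"
  obtains V where "open V" "p \<in> V" "V \<subseteq> U"
    "\<And>k v q. v \<in> Lat \<Longrightarrow> q \<in> V \<Longrightarrow> act k v q \<in> V \<Longrightarrow> k = 0 \<and> v = 0"
proof -
  obtain \<epsilon> where \<epsilon>: "\<epsilon> > 0" "\<And>v. v \<in> Lat \<Longrightarrow> norm v < \<epsilon> \<Longrightarrow> v = 0"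
    using Lat_discrete by blast
  define y where "y = Im (fst p)"
  have y: "y > 0" using assms by (auto simp: y_def upper_half_plane_def)
  \<comment> \<open>With this width, \<open>r * (y - c) - (y + c)\<close> equals
    \<open>y / 2 * ((r - 1)\<^sup>2 / r)\<close>, which is positive: multiplication by
    \<open>r\<close> moves the strip off itself.\<close>
  define c where "c = y / 2 * (1 - inverse r)"
  have c: "c > 0" "y + c < r * (y - c)" "c < y"
  proof -
    have ir: "0 < inverse r" "inverse r < 1" using r_gt1 by (auto simp: inverse_less_1_iff)
    show "c > 0" using y ir by (simp add: c_def)
    have "c = y / 2 - y * inverse r / 2" by (simp add: c_def right_diff_distrib)
    then show "c < y" using y mult_pos_pos[OF y ir(1)] by linarith
    have "r * (y - c) - (y + c) = y / 2 * ((r - 1)\<^sup>2 / r)"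
      using r_nz by (simp add: c_def field_simps power2_eq_square)
    moreover have "y / 2 * ((r - 1)\<^sup>2 / r) > 0" using y r_gt1 by simp
    ultimately show "y + c < r * (y - c)" by linarith
  qed
  define V where "V = ball p (\<epsilon> / 2) \<inter> {q. y - c < Im (fst q)} \<inter> {q. Im (fst q) < y + c}"
  show thesis
  proof
    show "open V"
      unfolding V_def by (intro open_Int open_ball open_Collect_less continuous_intros)
    show "p \<in> V" using c \<epsilon> by (auto simp: V_def y_def)
    show "V \<subseteq> U" using c by (auto simp: V_def upper_half_plane_def)
    fix k v q assume v: "v \<in> Lat" and q: "q \<in> V" and aq: "act k v q \<in> V"
    have im: "Im (fst (act k v q)) = r powi k * Im (fst q)"
      by (simp add: act_def del: of_real_power_int)
    have iq: "y - c < Im (fst q)" "Im (fst q) < y + c"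
        "y - c < r powi k * Im (fst q)" "r powi k * Im (fst q) < y + c"
      using q aq im by (auto simp: V_def)
    have big: "False" if "i > 0" "y - c < s" "r powi i * s < y + c" for i :: int and s
    proof -
      have "r powi 1 \<le> r powi i" using r_gt1 that by (intro power_int_increasing) auto
      then have "r * (y - c) \<le> r powi i * s"
        using that c r_pos by (intro mult_mono) auto
      then show False using that c by simp
    qed
    have k: "k = 0"
    proof (rule ccontr)
      assume "k \<noteq> 0"
      then consider "k > 0" | "- k > 0" by linarith
      then show False
      proof cases
        case 1 then show False using big[OF 1 iq(1,4)] by simp
      next
        case 2
        \<comment> \<open>For negative exponents, \<open>q\<close> and its image exchange
          roles.\<close>
        have "r powi (- k) * (r powi k * Im (fst q)) = Im (fst q)"
          using r_nz by (simp add: power_int_minus)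
        then have "r powi (- k) * (r powi k * Im (fst q)) < y + c" using iq(2) by (simp only:)
        then show False using big[OF 2 iq(3)] by blast
      qed
    qed
    have "act k v q - q = (complex_of_real (fst v), snd v)"
      by (simp add: k act_def prod_eq_iff)
    then have "norm (act k v q - q) = norm v"
      by (simp add: norm_prod_def)
    moreover have "norm (act k v q - q) < \<epsilon>"
      using dist_triangle_half_r[of p "act k v q" \<epsilon> q] q aq by (simp add: V_def dist_norm)
    ultimately show "k = 0 \<and> v = 0" using \<epsilon> v k by simp
  qed
qed

lemma deck: "deck_action U G"
proof
  interpret B: group "BijGroup U" by (rule group_BijGroup)
  have sub: "subgroup (carrier G) (BijGroup U)"
    unfolding inoue_group_def by (rule B.subgroup_subgroup_generated)
  have GB: "g \<in> carrier G \<Longrightarrow> g \<in> carrier (BijGroup U)" for g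
    using subgroup.subset[OF sub] by blast
  show "open U" by (rule open_U)
  show "g x \<in> U" if "g \<in> carrier G" "x \<in> U" for g x
    using BijGroup_maps[where S = U] GB that by blast
  show "continuous_on U g" if g: "g \<in> carrier G" for g
  proof -
    obtain k v where "\<And>p. p \<in> U \<Longrightarrow> g p = act k v p" using G_act[OF g] by metis
    moreover have "continuous_on U (act k v)"
      unfolding act_def by (intro continuous_intros)
    ultimately show ?thesis using continuous_on_cong by (metis (no_types, lifting))
  qed
  show "\<exists>e\<in>carrier G. \<forall>x\<in>U. e x = x"
    using subgroup.one_closed[OF sub] BijGroup_one[where S = U] by blast
  show "\<exists>k\<in>carrier G. \<forall>x\<in>U. k x = g (h x)" if "g \<in> carrier G" "h \<in> carrier G" for g h
    using subgroup.m_closed[OF sub that] BijGroup_mult[where S = U] GB that by blast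
  show "\<exists>h\<in>carrier G. \<forall>x\<in>U. h (g x) = x \<and> g (h x) = x" if "g \<in> carrier G" for g
    using subgroup.m_inv_closed[OF sub that] BijGroup_inv[where S = U] GB that by blast
  show "\<exists>V. open V \<and> x \<in> V \<and> V \<subseteq> U \<and> (\<forall>g\<in>carrier G. \<forall>y\<in>V. g y \<in> V \<longrightarrow> (\<forall>z\<in>U. g z = z))"
    if x: "x \<in> U" for x
  proof -
    obtain V where V: "open V" "x \<in> V" "V \<subseteq> U"
      "\<And>k v q. v \<in> Lat \<Longrightarrow> q \<in> V \<Longrightarrow> act k v q \<in> V \<Longrightarrow> k = 0 \<and> v = 0"
      using act_disc[OF x] by metis
    have "g z = z" if g: "g \<in> carrier G" and y: "y \<in> V" "g y \<in> V" and z: "z \<in> U" for g y z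
    proof -
      obtain k v where kv: "v \<in> Lat" "\<And>p. p \<in> U \<Longrightarrow> g p = act k v p" using G_act[OF g] by metis
      have "y \<in> U" using V(3) y(1) by blast
      then have "k = 0 \<and> v = 0" using V(4)[OF kv(1) y(1)] kv(2) y(2) by simp
      with kv(2)[OF z] act_0 show ?thesis by simp
    qed
    then have "\<forall>g\<in>carrier G. \<forall>y\<in>V. g y \<in> V \<longrightarrow> (\<forall>z\<in>U. g z = z)" by simp
    with V(1-3) show ?thesis by (intro exI[of _ V] conjI)
  qed
qed

end

section \<open>Equivariant antiholomorphic maps\<close>

text \<open>A complex homogeneous derivative, restricted to either coordinate axis, is
  multiplication by a constant in each component.\<close>

lemma holomorphic2_on_slices:
  assumes hol: "holomorphic2_on \<Phi> (A \<times> B)"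
  shows "w \<in> A \<Longrightarrow> (\<lambda>z. fst (\<Phi> (w, z))) holomorphic_on B"
    and "w \<in> A \<Longrightarrow> (\<lambda>z. snd (\<Phi> (w, z))) holomorphic_on B"
    and "z \<in> B \<Longrightarrow> (\<lambda>w. fst (\<Phi> (w, z))) holomorphic_on A"
    and "z \<in> B \<Longrightarrow> (\<lambda>w. snd (\<Phi> (w, z))) holomorphic_on A"
proof -
  have *: "(\<lambda>z. fst (\<Phi> (w, z))) field_differentiable at z" "(\<lambda>z. snd (\<Phi> (w, z))) field_differentiable at z"
    "(\<lambda>w. fst (\<Phi> (w, z))) field_differentiable at w" "(\<lambda>w. snd (\<Phi> (w, z))) field_differentiable at w"
    if wz: "w \<in> A" "z \<in> B" for w z
  proof -
    obtain D where D: "(\<Phi> has_derivative D) (at (w, z))" "complex_homogeneous D"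
      using hol wz unfolding holomorphic2_on_def by blast
    have hom: "D (c * u, c * v) = (c * fst (D (u, v)), c * snd (D (u, v)))" for c u v
      using D(2) unfolding complex_homogeneous_def by blast
    have "((\<lambda>z. \<Phi> (w, z)) has_derivative (\<lambda>h. D (0, h))) (at z)"
      using has_derivative_compose[OF has_derivative_Pair[OF has_derivative_const has_derivative_ident] D(1)] .
    moreover have "(\<lambda>h. D (0, h)) = (\<lambda>h. (h * fst (D (0, 1)), h * snd (D (0, 1))))"
    proof
      show "D (0, h) = (h * fst (D (0, 1)), h * snd (D (0, 1)))" for h
        using hom[of h 0 1] by (simp only: mult_zero_right mult_1_right)
    qed
    ultimately have 1: "((\<lambda>z. \<Phi> (w, z)) has_derivative (\<lambda>h. (h * fst (D (0, 1)), h * snd (D (0, 1))))) (at z)"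
      by (rule back_subst[where P = "\<lambda>D. (_ has_derivative D) _"])
    have "((\<lambda>w. \<Phi> (w, z)) has_derivative (\<lambda>h. D (h, 0))) (at w)"
      using has_derivative_compose[OF has_derivative_Pair[OF has_derivative_ident has_derivative_const] D(1)] .
    moreover have "(\<lambda>h. D (h, 0)) = (\<lambda>h. (h * fst (D (1, 0)), h * snd (D (1, 0))))"
    proof
      show "D (h, 0) = (h * fst (D (1, 0)), h * snd (D (1, 0)))" for h
        using hom[of h 1 0] by (simp only: mult_zero_right mult_1_right)
    qed
    ultimately have 2: "((\<lambda>w. \<Phi> (w, z)) has_derivative (\<lambda>h. (h * fst (D (1, 0)), h * snd (D (1, 0))))) (at w)"
      by (rule back_subst[where P = "\<lambda>D. (_ has_derivative D) _"])
    show "(\<lambda>z. fst (\<Phi> (w, z))) field_differentiable at z" "(\<lambda>z. snd (\<Phi> (w, z))) field_differentiable at z"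
      "(\<lambda>w. fst (\<Phi> (w, z))) field_differentiable at w" "(\<lambda>w. snd (\<Phi> (w, z))) field_differentiable at w"
      using has_derivative_fst[OF 1] has_derivative_snd[OF 1] has_derivative_fst[OF 2] has_derivative_snd[OF 2]
      unfolding field_differentiable_def has_field_derivative_def
      by (auto simp: mult_commute_abs)
  qed
  show "w \<in> A \<Longrightarrow> (\<lambda>z. fst (\<Phi> (w, z))) holomorphic_on B"
    "w \<in> A \<Longrightarrow> (\<lambda>z. snd (\<Phi> (w, z))) holomorphic_on B"
    "z \<in> B \<Longrightarrow> (\<lambda>w. fst (\<Phi> (w, z))) holomorphic_on A"
    "z \<in> B \<Longrightarrow> (\<lambda>w. snd (\<Phi> (w, z))) holomorphic_on A"
    using * unfolding holomorphic_on_def by (blast intro: field_differentiable_at_within)+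
qed

text \<open>The values keep distance at least 1 from \<i>, so Liouville applies to the inverse of
  \<open>f z - \<i>\<close>.\<close>

lemma entire_into_lower_half_plane_constant:
  assumes "f holomorphic_on UNIV" "\<And>z. Im (f z) < 0"
  shows "f z = f z'"
proof -
  have nz: "f z - \<i> \<noteq> 0" for z
    using assms(2)[of z] by (auto simp: complex_eq_iff)
  have "(\<lambda>z. inverse (f z - \<i>)) holomorphic_on UNIV"
    using assms(1) nz by (auto intro!: holomorphic_intros)
  moreover have "cmod (inverse (f z - \<i>)) \<le> 1" for z
  proof -
    have "1 \<le> \<bar>Im (f z - \<i>)\<bar>" using assms(2)[of z] by simp
    then have "1 \<le> cmod (f z - \<i>)" using abs_Im_le_cmod[of "f z - \<i>"] by linarith
    then show ?thesis by (simp add: norm_inverse inverse_le_1_iff)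
  qed
  then have "bounded (range (\<lambda>z. inverse (f z - \<i>)))"
    by (auto simp: bounded_iff)
  ultimately have "(\<lambda>z. inverse (f z - \<i>)) constant_on UNIV"
    by (rule Liouville_theorem)
  then have "inverse (f z - \<i>) = inverse (f z' - \<i>)"
    unfolding constant_on_def by (metis UNIV_I)
  then show ?thesis by simp
qed

lemma entire_additive_imp_affine:
  assumes hol: "g holomorphic_on UNIV" and add: "\<And>z u. g (z + u) - g z = g u - g 0"
  shows "g z = g 0 + (g 1 - g 0) * z"
proof -
  obtain c where c: "(g has_field_derivative c) (at 0)"
    using hol holomorphic_on_imp_differentiable_at[of g UNIV 0] by (auto simp: field_differentiable_def)
  have der: "(g has_field_derivative c) (at z)" for z
  proof -
    \<comment> \<open>Translating \<open>g\<close> by \<open>z\<close> changes it only by a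
      constant, so its derivative at \<open>z\<close> is the one at 0.\<close>
    have "(\<lambda>x. g z - g 0 + g (x - z)) = g"
    proof
      fix x show "g z - g 0 + g (x - z) = g x" using add[of z "x - z"] by (simp add: algebra_simps)
    qed
    moreover have "((\<lambda>x. g z - g 0 + g (x - z)) has_field_derivative c) (at z)"
    proof -
      have "((\<lambda>x. g (x - z)) has_field_derivative c * 1) (at z)"
        by (rule DERIV_chain2) (use c in \<open>auto intro!: derivative_eq_intros\<close>)
      then show ?thesis by (auto intro!: derivative_eq_intros)
    qed
    ultimately show ?thesis by (simp only:)
  qed
  have "\<exists>d. \<forall>z\<in>UNIV. g z - c * z = d"
  proof (rule has_field_derivative_zero_constant)
    show "((\<lambda>z. g z - c * z) has_field_derivative 0) (at z within UNIV)" for z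
      by (rule derivative_eq_intros der refl | simp)+
  qed auto
  then obtain d where "\<And>z. g z - c * z = d" by blast
  then have d: "g z = d + c * z" for z by (simp add: diff_eq_eq add.commute)
  show ?thesis using d[of 0] d[of 1] d[of z] by simp
qed

section \<open>Consequences of equivariance under the lattice and the dilation\<close>

context inoue
begin

text \<open>Lattice translations preserve the imaginary part of the first variable and have full
  rank on the real hypersurface where it equals \<open>Im w\<close>. So \<open>h\<close> is bounded
  there by its values over a compact fundamental box, and Liouville applies on the complex line of
  fixed \<open>w\<close>.\<close>

lemma Liouville_lattice_periodic:
  assumes cont: "continuous_on U h" and w: "w \<in> upper_half_plane"
    and hol: "(\<lambda>z. h (w, z)) holomorphic_on UNIV"
    and per: "\<And>v p. v \<in> Lat \<Longrightarrow> p \<in> U \<Longrightarrow> h (act 0 v p) = h p"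
  shows "h (w, z) = h (w, z')"
proof -
  define q where "q y = (complex_of_real (fst (ell y)) + \<i> * complex_of_real (Im w), snd (ell y))" for y
  have qU: "q y \<in> U" for y using w by (simp add: q_def upper_half_plane_def)
  have "continuous_on (cbox 0 1) ell"
    using linear_continuous_on linear_ell linear_conv_bounded_linear by blast
  then have cq: "continuous_on (cbox 0 1) q"
    unfolding q_def by (intro continuous_intros)
  have "q ` cbox 0 1 \<subseteq> U" using qU by blast
  then have "compact (h ` q ` cbox 0 1)"
    using cont cq by (intro compact_continuous_image continuous_on_subset[OF cont] compact_cbox)
  moreover have "range (\<lambda>z. h (w, z)) \<subseteq> h ` q ` cbox 0 1"
  proof clarify
    fix z
    obtain y where y: "ell y = (Re w, z)" using surj_ell by (metis surj_def)
    \<comment> \<open>Subtracting the integral parts of the coordinates moves the point into the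
      box.\<close>
    define n :: "real^3" where "n = (\<chi> i. of_int \<lfloor>y $ i\<rfloor>)"
    have n: "ell n \<in> Lat" unfolding Lat_def n_def by auto
    have "y - n \<in> cbox 0 1"
      unfolding n_def mem_box_cart by (auto simp: algebra_simps) linarith
    moreover have "(w, z) = act 0 (ell n) (q (y - n))"
      unfolding q_def act_def linear_diff[OF linear_ell] y by (simp add: complex_eq_iff)
    then have "h (w, z) = h (q (y - n))" using per[OF n qU] by simp
    ultimately show "h (w, z) \<in> h ` q ` cbox 0 1" by blast
  qed
  ultimately have "bounded (range (\<lambda>z. h (w, z)))"
    using bounded_subset compact_imp_bounded by blast
  with hol have "(\<lambda>z. h (w, z)) constant_on UNIV" by (rule Liouville_theorem)
  then show ?thesis unfolding constant_on_def by auto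
qed

lemma act_inverse: "act (- k) (- dilate (- k) v) (act k v p) = p"
  by (simp add: act_act act_0)

lemma r_powi_inj: "r powi k = r powi l \<Longrightarrow> k = l"
  using power_int_strict_increasing[of k l r] power_int_strict_increasing[of l k r] r_gt1
  by (metis less_irrefl linorder_neqE)

text \<open>The exponent can be read off from the imaginary part of the first component, which
  translations leave unchanged.\<close>

lemma act_inj_exponent:
  assumes "p \<in> U" "act k v p = act l w p"
  shows "k = l"
proof -
  have "Im (fst (act k v p)) = r powi k * Im (fst p)" for k v
    by (simp add: act_def del: of_real_power_int)
  then have "r powi k * Im (fst p) = r powi l * Im (fst p)" using assms(2) by metis
  moreover have "Im (fst p) \<noteq> 0" using assms(1) by (auto simp: upper_half_plane_def)
  ultimately show ?thesis using r_powi_inj by simp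
qed

text \<open>Let \<open>\<kappa> i\<close> be the exponents of the dilations into which \<open>F\<close> transports the translations.
  Conjugation by the dilation does not change exponents, so \<open>\<kappa>\<close> is fixed by the integral
  matrix \<open>m\<close>, which has no eigenvalue 1.\<close>

lemma lattice_translation_equivariant:
  assumes F: "F ` U \<subseteq> U"
    and dil: "\<And>p. p \<in> U \<Longrightarrow> F (act 1 0 p) = act e v\<^sub>0 (F p)"
    and tra: "\<And>i. \<exists>k v. \<forall>p\<in>U. F (act 0 (ell (axis i 1)) p) = act k v (F p)"
    and u: "u \<in> Lat"
  shows "\<exists>v. \<forall>p\<in>U. F (act 0 u p) = act 0 v (F p)"
proof -
  \<comment> \<open>Only the exponent is recorded: exponents add under composition, whatever the
    translation parts are.\<close>
  define tr where "tr x k \<longleftrightarrow> (\<exists>v. \<forall>p\<in>U. F (act 0 (ell x) p) = act k v (F p))" for x k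
  have act_ell_add: "act 0 (ell (x + y)) p = act 0 (ell x) (act 0 (ell y) p)" for x y p
    by (simp add: act_act linear_add[OF linear_ell] dilate_def)
  have tr_add: "tr (x + y) (k + l)" if "tr x k" "tr y l" for x y k l
  proof -
    obtain v v' where v: "\<forall>p\<in>U. F (act 0 (ell x) p) = act k v (F p)"
      "\<forall>p\<in>U. F (act 0 (ell y) p) = act l v' (F p)"
      using \<open>tr x k\<close> \<open>tr y l\<close> unfolding tr_def by blast
    have "F (act 0 (ell (x + y)) p) = act (k + l) (v + dilate k v') (F p)" if "p \<in> U" for p
    proof -
      have "F (act 0 (ell (x + y)) p) = act k v (act l v' (F p))"
        using v act_in_U[OF that] that by (simp only: act_ell_add)
      then show ?thesis by (simp only: act_act)
    qed
    then show ?thesis unfolding tr_def by blast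
  qed
  have tr_0: "tr 0 0"
    unfolding tr_def using linear_0[OF linear_ell] act_0 by (intro exI[of _ 0]) simp
  have tr_minus: "tr (- x) (- k)" if "tr x k" for x k
  proof -
    obtain v where v: "\<forall>p\<in>U. F (act 0 (ell x) p) = act k v (F p)"
      using \<open>tr x k\<close> unfolding tr_def by blast
    have "F (act 0 (ell (- x)) p) = act (- k) (- dilate (- k) v) (F p)" if "p \<in> U" for p
    proof -
      have "act 0 (ell x) (act 0 (ell (- x)) p) = p"
        by (simp add: act_ell_add[symmetric] linear_0[OF linear_ell] act_0)
      then have "F p = act k v (F (act 0 (ell (- x)) p))"
        using v act_in_U[OF that] by metis
      then show ?thesis by (simp add: act_inverse)
    qed
    then show ?thesis unfolding tr_def by blast
  qed
  have tr_scale: "tr (of_int n *\<^sub>R x) (n * k)" if x: "tr x k" for x k n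
  proof (induction n rule: int_induct[where k = 0])
    case base
    then show ?case using tr_0 by simp
  next
    case (step1 i)
    then show ?case using tr_add[OF step1(2) x] by (simp add: algebra_simps)
  next
    case (step2 i)
    then show ?case using tr_add[OF step2(2) tr_minus[OF x]] by (simp add: algebra_simps)
  qed
  have tr_unique: "k = l" if "tr x k" "tr x l" for x k l
  proof -
    have i: "(\<i>, 0) \<in> U" by (simp add: upper_half_plane_def)
    then have "F (\<i>, 0) \<in> U" using F by blast
    moreover obtain v w where "F (act 0 (ell x) (\<i>, 0)) = act k v (F (\<i>, 0))"
        "F (act 0 (ell x) (\<i>, 0)) = act l w (F (\<i>, 0))"
      using \<open>tr x k\<close> \<open>tr x l\<close> i unfolding tr_def by blast
    ultimately show ?thesis using act_inj_exponent by metis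
  qed
  have tr_dilate: "tr (\<chi> j. \<Sum>i\<in>UNIV. of_int (m i j) * x $ i) k" if "tr x k" for x k
  proof -
    let ?x = "\<chi> j. \<Sum>i\<in>UNIV. of_int (m i j) * x $ i"
    obtain v where v: "\<forall>p\<in>U. F (act 0 (ell x) p) = act k v (F p)"
      using \<open>tr x k\<close> unfolding tr_def by blast
    \<comment> \<open>The translation part of \<open>act k v\<close> conjugated by
      \<open>act e v\<^sub>0\<close>; the exponents \<open>e\<close> and \<open>-e\<close>
      cancel.\<close>
    let ?v = "v\<^sub>0 + dilate e (v + dilate k (- dilate (- e) v\<^sub>0))"
    have "F (act 0 (ell ?x) p) = act k ?v (F p)" if p: "p \<in> U" for p
    proof -
      define q where "q = act (- 1) 0 p"
      have q: "q \<in> U" "p = act 1 0 q"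
        unfolding q_def using act_in_U[OF p]
        by blast (simp add: act_def power_int_minus prod_eq_iff r_nz beta_nz)
      have "act 0 (ell ?x) p = act 1 0 (act 0 (ell x) q)"
        unfolding q(2) act_act ell_scale by (simp add: dilate_def zero_prod_def)
      then have "F (act 0 (ell ?x) p) = act e v\<^sub>0 (act k v (F q))"
        using dil[OF act_in_U[OF q(1), of 0 "ell x"]] v[rule_format, OF q(1)] by (simp only:)
      moreover have "F q = act (- e) (- dilate (- e) v\<^sub>0) (F p)"
        using dil[OF q(1)] q(2) by (simp add: act_inverse)
      ultimately show ?thesis by (simp add: act_act)
    qed
    then show ?thesis unfolding tr_def by blast
  qed
  obtain \<kappa> where \<kappa>: "tr (axis i 1) (\<kappa> i)" for i
    using tra unfolding tr_def by metis
  have tr_int: "tr (\<chi> j. of_int (n j)) (\<Sum>j\<in>UNIV. n j * \<kappa> j)" for n :: "3 \<Rightarrow> int"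
  proof -
    have "(\<chi> j. of_int (n j)) = of_int (n 1) *\<^sub>R axis 1 1 + of_int (n 2) *\<^sub>R axis 2 1
        + of_int (n 3) *\<^sub>R (axis 3 1 :: real^3)"
      by (simp add: vec_eq_iff forall_3 axis_def)
    then show ?thesis
      unfolding sum_3 by (simp only:) (intro tr_add tr_scale \<kappa>)
  qed
  have "\<kappa> i = 0" for i
  proof (rule fixed_0)
    fix i
    \<comment> \<open>The dilation takes the \<open>i\<close>-th generator to the vector given by
      row \<open>i\<close> of \<open>m\<close>. Its exponent is still \<open>\<kappa> i\<close>, and
      by additivity it is also the product of that row with \<open>\<kappa>\<close>.\<close>
    have "(\<chi> j. \<Sum>l\<in>UNIV. real_of_int (m l j) * axis i 1 $ l) = (\<chi> j. real_of_int (m i j))"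
      by (simp add: axis_def if_distrib cong: if_cong)
    then have "tr (\<chi> j. of_int (m i j)) (\<kappa> i)"
      using tr_dilate[OF \<kappa>[of i]] by simp
    then show "(\<Sum>j\<in>UNIV. m i j * \<kappa> j) = \<kappa> i"
      using tr_unique tr_int by blast
  qed
  then have *: "tr (\<chi> j. of_int (n j)) 0" for n :: "3 \<Rightarrow> int"
    using tr_int[of n] by simp
  obtain x :: "real^3" where x: "u = ell x" "\<forall>i. x $ i \<in> \<int>" using u unfolding Lat_def by blast
  then have "x = (\<chi> j. of_int \<lfloor>x $ j\<rfloor>)" by (simp add: vec_eq_iff)
  then have "tr x 0" using * by metis
  then show ?thesis unfolding tr_def x(1) .
qed

text \<open>The periods of \<open>c\<close> are closed under division by \<open>r\<close>, hence accumulate at 0.\<close>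

lemma periodic_dilation_equivariant_constant:
  assumes hol: "c holomorphic_on upper_half_plane"
    and per: "\<And>i w. w \<in> upper_half_plane \<Longrightarrow> c (w + complex_of_real (a $ i)) = c w"
    and dil: "\<And>w. w \<in> upper_half_plane \<Longrightarrow> c (complex_of_real r * w) = \<mu> * c w"
    and "\<mu> \<noteq> 0"
  shows "\<exists>C. \<forall>w\<in>upper_half_plane. c w = C"
proof -
  \<comment> \<open>If all \<open>a $ i\<close> vanished, \<open>ell\<close> could not be
    surjective.\<close>
  obtain i where i: "a $ i \<noteq> 0"
  proof (rule ccontr)
    assume "\<not> thesis"
    then have "a $ i = 0" for i using that by blast
    then have "fst (ell x) = 0" for x by (simp add: ell_def)
    then show False using surj_ell by (metis fst_conv surj_def zero_neq_one)
  qed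
  \<comment> \<open>If \<open>x\<close> is a period, so is \<open>x / r\<close>: scaling by
    \<open>r\<close> turns a shift by \<open>x / r\<close> into a shift by \<open>x\<close>, and the
    factor \<open>\<mu>\<close> cancels.\<close>
  have per_n: "w \<in> upper_half_plane \<Longrightarrow> c (w + complex_of_real (a $ i / r ^ n)) = c w" for w n
  proof (induction n arbitrary: w)
    case (Suc n)
    let ?x = "complex_of_real (a $ i / r ^ Suc n)"
    have w': "complex_of_real r * w \<in> upper_half_plane" "w + ?x \<in> upper_half_plane"
      using Suc.prems r_pos by (auto simp: upper_half_plane_def simp del: of_real_divide)
    have "\<mu> * c (w + ?x) = c (complex_of_real r * (w + ?x))" using dil[OF w'(2)] by simp
    also have "complex_of_real r * (w + ?x) = complex_of_real r * w + complex_of_real (a $ i / r ^ n)"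
      using r_nz by (simp add: distrib_left)
    also have "c \<dots> = c (complex_of_real r * w)" using Suc.IH w'(1) by blast
    also have "\<dots> = \<mu> * c w" using dil Suc.prems by blast
    finally show ?case using \<open>\<mu> \<noteq> 0\<close> by simp
  qed (use per in simp)
  have "(c has_field_derivative 0) (at w within upper_half_plane)" if w: "w \<in> upper_half_plane" for w
  proof -
    have op: "open upper_half_plane" unfolding upper_half_plane_def by (rule open_halfspace_Im_gt)
    obtain c' where c': "(c has_field_derivative c') (at w)"
      using holomorphic_on_imp_differentiable_at[OF hol op w] by (auto simp: field_differentiable_def)
    have lim: "(\<lambda>n. complex_of_real (a $ i / r ^ n)) \<longlonglongrightarrow> 0"
    proof -
      have "(\<lambda>n. a $ i * (inverse r) ^ n) \<longlonglongrightarrow> a $ i * 0"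
        using r_gt1 by (intro tendsto_intros LIMSEQ_realpow_zero) (auto simp: inverse_less_1_iff)
      then have "(\<lambda>n. complex_of_real (a $ i / r ^ n)) \<longlonglongrightarrow> complex_of_real 0"
        by (intro tendsto_of_real) (simp add: field_simps)
      then show ?thesis by simp
    qed
    then have "filterlim (\<lambda>n. complex_of_real (a $ i / r ^ n)) (at 0) sequentially"
      using i r_nz by (auto simp: filterlim_at)
    \<comment> \<open>Along these periods the difference quotients are all 0, which forces the
      derivative to vanish.\<close>
    then have "(\<lambda>n. (c (w + complex_of_real (a $ i / r ^ n)) - c w) / complex_of_real (a $ i / r ^ n)) \<longlonglongrightarrow> c'"
      using c' unfolding DERIV_def by (rule filterlim_compose[rotated])
    then have "c' = 0"
      using per_n[OF w] by (simp add: LIMSEQ_const_iff)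
    then show ?thesis using c' has_field_derivative_at_within by blast
  qed
  moreover have "convex upper_half_plane"
    unfolding upper_half_plane_def by (rule convex_halfspace_Im_gt)
  ultimately show ?thesis by (intro has_field_derivative_zero_constant)
qed

lemma antiholomorphic_equivariant_vertically_constant:
  assumes cont: "continuous_on U F" and F: "F ` U \<subseteq> U"
    and hol: "holomorphic2_on (map_prod cnj cnj \<circ> F) U"
    and dil: "\<And>p. p \<in> U \<Longrightarrow> F (act 1 0 p) = act e v\<^sub>0 (F p)"
    and tra: "\<And>i. \<exists>k v. \<forall>p\<in>U. F (act 0 (ell (axis i 1)) p) = act k v (F p)"
    and w: "w \<in> upper_half_plane"
  shows "F (w, z) = F (w, z')"
proof -
  define \<Phi> where "\<Phi> w z = cnj (snd (F (w, z)))" for w z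
  note slices = holomorphic2_on_slices[OF hol, simplified]
  have hol_z: "\<Phi> w holomorphic_on UNIV" if "w \<in> upper_half_plane" for w
    using slices(2)[OF that] by (simp add: \<Phi>_def[abs_def])
  have hol_w: "(\<lambda>w. \<Phi> w z) holomorphic_on upper_half_plane" for z
    using slices(4) by (simp add: \<Phi>_def[abs_def])
  have diff_const: "\<Phi> w (z + u) - \<Phi> w z = \<Phi> w (z' + u) - \<Phi> w z'"
    if w: "w \<in> upper_half_plane" for w z z' u
  proof -
    \<comment> \<open>A lattice translation adds to \<open>\<Phi>\<close> a constant depending only
      on the translation, which cancels in this difference.\<close>
    define h where "h p = \<Phi> (fst p) (snd p + u) - \<Phi> (fst p) (snd p)" for p
    have "h (w, z) = h (w, z')"
    proof (rule Liouville_lattice_periodic[OF _ w])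
      have "continuous_on U (\<lambda>p. F (fst p, snd p + u))"
        by (rule continuous_on_compose2[OF cont]) (auto intro!: continuous_intros)
      then show "continuous_on U h"
        unfolding h_def \<Phi>_def using cont by (auto intro!: continuous_intros)
      have "(\<lambda>z. \<Phi> w (z + u)) holomorphic_on UNIV"
        using holomorphic_on_compose_gen[of "\<lambda>z. z + u" UNIV "\<Phi> w" UNIV, OF _ hol_z[OF w]]
        by (simp add: o_def holomorphic_on_add)
      then show "(\<lambda>z. h (w, z)) holomorphic_on UNIV"
        unfolding h_def using hol_z[OF w] by (auto intro!: holomorphic_intros)
      fix v p assume v: "v \<in> Lat" and p: "p \<in> U"
      obtain v' where v': "\<forall>p\<in>U. F (act 0 v p) = act 0 v' (F p)"
        using lattice_translation_equivariant[OF F dil tra v] by blast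
      have sh: "\<Phi> (fst p + complex_of_real (fst v)) (z + snd v) = \<Phi> (fst p) z + cnj (snd v')" for z
      proof -
        have "(fst p, z) \<in> U" using p by auto
        then have "F (act 0 v (fst p, z)) = act 0 v' (F (fst p, z))" using v' by blast
        then show ?thesis by (simp add: \<Phi>_def act_def)
      qed
      show "h (act 0 v p) = h p"
        using sh[of "snd p + u"] sh[of "snd p"] by (simp add: h_def act_def algebra_simps)
    qed
    then show ?thesis by (simp add: h_def)
  qed
  define c where "c w = \<Phi> w 1 - \<Phi> w 0" for w
  have affine: "\<Phi> w z = \<Phi> w 0 + c w * z" if w: "w \<in> upper_half_plane" for w z
    unfolding c_def
  proof (rule entire_additive_imp_affine[OF hol_z[OF w]])
    show "\<Phi> w (z + u) - \<Phi> w z = \<Phi> w u - \<Phi> w 0" for z u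
      using diff_const[OF w, of z u 0] by simp
  qed
  \<comment> \<open>The numerator is the conjugated multiplier on the target; dividing by \<beta>
    accounts for the rescaling of \<open>z\<close> in the source.\<close>
  define \<mu> where "\<mu> = cnj \<beta> powi e / \<beta>"
  have \<mu>: "\<mu> \<noteq> 0" using beta_nz by (simp add: \<mu>_def)
  have c_dil: "c (complex_of_real r * w) = \<mu> * c w" if w: "w \<in> upper_half_plane" for w
  proof -
    have w': "complex_of_real r * w \<in> upper_half_plane"
      using w r_pos by (simp add: upper_half_plane_def)
    have "\<Phi> (complex_of_real r * w) (\<beta> * z) = cnj \<beta> powi e * \<Phi> w z + cnj (snd v\<^sub>0)" for z
      using dil[of "(w, z)"] w by (simp add: \<Phi>_def act_def)
    from this[of 0] this[of 1] have "c (complex_of_real r * w) * \<beta> = cnj \<beta> powi e * c w"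
      using affine[OF w', of \<beta>] by (simp add: c_def algebra_simps)
    then show ?thesis using beta_nz by (simp add: \<mu>_def field_simps)
  qed
  have c_per: "c (w + complex_of_real (a $ i)) = c w" if w: "w \<in> upper_half_plane" for w i
  proof -
    have w': "w + complex_of_real (a $ i) \<in> upper_half_plane"
      using w by (simp add: upper_half_plane_def)
    have "ell (axis i 1) \<in> Lat" unfolding Lat_def by (auto simp: axis_def)
    then obtain v' where "\<forall>p\<in>U. F (act 0 (ell (axis i 1)) p) = act 0 v' (F p)"
      using lattice_translation_equivariant[OF F dil tra] by blast
    moreover have "ell (axis i 1) = (a $ i, b $ i)"
      by (simp add: ell_def axis_def if_distrib[of complex_of_real]
          if_distrib[of "\<lambda>x. x * _"] cong: if_cong)
    ultimately have sh: "\<Phi> (w + complex_of_real (a $ i)) (z + b $ i) = \<Phi> w z + cnj (snd v')" for z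
      using w by (force simp: \<Phi>_def act_def)
    \<comment> \<open>The shift moves the base point from 0 to \<open>b $ i\<close>, but the
      increment of \<open>\<Phi>\<close> over a step of length 1 does not depend on the base
      point.\<close>
    show ?thesis
      using diff_const[OF w', of "b $ i" 1 0] sh[of 0] sh[of 1] by (simp add: c_def add.commute)
  qed
  have "c holomorphic_on upper_half_plane"
    unfolding c_def using hol_w by (intro holomorphic_intros)
  then obtain C where C: "\<And>w. w \<in> upper_half_plane \<Longrightarrow> c w = C"
    using periodic_dilation_equivariant_constant[of c \<mu>] c_per c_dil \<mu> by metis
  have "C = 0"
  proof (rule ccontr)
    assume "C \<noteq> 0"
    have i: "\<i> \<in> upper_half_plane" "complex_of_real r * \<i> \<in> upper_half_plane"
      using r_pos by (auto simp: upper_half_plane_def)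
    have "\<mu> = 1" using c_dil[OF i(1)] C[OF i(1)] C[OF i(2)] \<open>C \<noteq> 0\<close> by simp
    then have eq: "\<beta> = cnj \<beta> powi e" using beta_nz by (simp add: \<mu>_def field_simps)
    \<comment> \<open>Taking absolute values and passing to the inverse squares gives the same
      identity for \<open>r\<close>, whose powers are pairwise distinct.\<close>
    have "cmod \<beta> = cmod \<beta> powi e"
      using arg_cong[OF eq, of cmod] by (simp add: norm_power_int)
    moreover have "r = inverse ((cmod \<beta>)\<^sup>2)" by (simp add: r_def inverse_eq_divide)
    ultimately have "r powi e = r powi 1"
      by (metis power_int_1_right power_int_inverse power_int_power power_int_mult mult.commute)
    then have "e = 1" by (rule r_powi_inj)
    then show False using eq beta_nonreal by (simp add: Reals_cnj_iff)
  qed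
  then have "snd (F (w, z)) = snd (F (w, z'))"
    using affine[OF w, of z] affine[OF w, of z'] C[OF w] by (simp add: \<Phi>_def)
  moreover have "fst (F (w, z)) = fst (F (w, z'))"
  proof -
    \<comment> \<open>Conjugation puts the first component in the lower half plane, where an entire
      function must be constant.\<close>
    have "Im (cnj (fst (F (w, z)))) < 0" for z
    proof -
      have "F (w, z) \<in> U" using F w by blast
      then show ?thesis by (auto simp: upper_half_plane_def)
    qed
    then have "cnj (fst (F (w, z))) = cnj (fst (F (w, z')))"
      using entire_into_lower_half_plane_constant[of "\<lambda>z. cnj (fst (F (w, z)))"] slices(1)[OF w] by auto
    then show ?thesis by simp
  qed
  ultimately show ?thesis by (simp add: prod_eq_iff)
qed

text \<open>Stated for injectivity so as to cover both biholomorphisms and involutions, each of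
  which has a left inverse.\<close>

theorem no_injective_antiholomorphic_map:
  assumes f: "holomorphic_map (inoue_surface \<beta> a b) (conjugate_surface (inoue_surface \<beta> a b)) f"
  shows "\<not> inj_on f (topspace (surface_top (inoue_surface \<beta> a b)))"
proof
  interpret deck_action U G by (rule deck)
  let ?q = "orbit_proj G"
  assume "inj_on f (topspace (surface_top (inoue_surface \<beta> a b)))"
  then have inj: "inj_on f (?q ` U)"
    by (simp add: inoue_surface_def orbit_surface_def topspace_orbit)
  have "continuous_map (orbit_topology U G) (orbit_topology U G) f"
    using f by (simp add: holomorphic_map_def inoue_surface_def orbit_surface_def conjugate_surface_def)
  then obtain F where F: "continuous_on U F" "F ` U \<subseteq> U"
    "\<And>x. x \<in> U \<Longrightarrow> ?q (F x) = f (?q x)"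
    "\<And>g. g \<in> carrier G \<Longrightarrow> \<exists>g'\<in>carrier G. \<forall>x\<in>U. F (g x) = g' (F x)"
    using orbit_map_lift[OF convex_U] by metis
  have hol: "holomorphic2_on (map_prod cnj cnj \<circ> F) U"
    using holomorphic_map_lift[OF deck _ F(1-3)] f unfolding inoue_surface_def by blast
  have equi: "\<exists>k v. \<forall>p\<in>U. F (act l u p) = act k v (F p)"
    if g: "g \<in> carrier G" "\<And>p. p \<in> U \<Longrightarrow> g p = act l u p" for g l u
  proof -
    obtain g' where g': "g' \<in> carrier G" "\<forall>x\<in>U. F (g x) = g' (F x)" using F(4)[OF g(1)] by blast
    obtain k v where kv: "\<And>p. p \<in> U \<Longrightarrow> g' p = act k v p" using G_act[OF g'(1)] by metis
    have "F (act l u p) = act k v (F p)" if "p \<in> U" for p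
    proof -
      have "F p \<in> U" using F(2) that by blast
      then show ?thesis using g'(2) kv g(2) that by metis
    qed
    then show ?thesis by blast
  qed
  obtain e v\<^sub>0 where dil: "\<forall>p\<in>U. F (act 1 0 p) = act e v\<^sub>0 (F p)"
    using equi[OF dilation_in_G dilation_act] by blast
  have const: "F (\<i>, z) = F (\<i>, 0)" for z
    using antiholomorphic_equivariant_vertically_constant[OF F(1,2) hol, of e v\<^sub>0 \<i> z 0] dil
      equi[OF translation_in_G translation_act] by (simp add: upper_half_plane_def)
  have iU: "(\<i>, z) \<in> U" for z by (simp add: upper_half_plane_def)
  have same: "?q (\<i>, z) = ?q (\<i>, 0)" for z
  proof (rule inj_onD[OF inj])
    show "f (?q (\<i>, z)) = f (?q (\<i>, 0))" using F(3)[OF iU] const by metis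
  qed (use iU in auto)
  \<comment> \<open>All points of the fibre over \<i> now share one orbit, whereas the projection is
    injective near \<open>(\<i>, 0)\<close>.\<close>
  obtain V where V: "open V" "(\<i>, 0) \<in> V" "V \<subseteq> U" "inj_on ?q V" using disc_inj[OF iU] by metis
  obtain \<epsilon> where \<epsilon>: "\<epsilon> > 0" "ball (\<i>, 0) \<epsilon> \<subseteq> V" using V openE by metis
  define z where "z = complex_of_real (\<epsilon> / 2)"
  have "dist (\<i>, 0) (\<i>, z) = \<epsilon> / 2"
    using \<epsilon> by (simp add: z_def dist_prod_def dist_norm del: of_real_divide)
  then have "(\<i>, z) \<in> V" using \<epsilon> by auto
  then have "(\<i>, z) = (\<i>, 0)" using V same inj_onD by metis
  then show False using \<epsilon> by (simp add: z_def)
qed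

end

theorem corollary4p9:
  fixes S :: "(complex \<times> complex) set complex_surface"
  assumes "type_I_inoue_surface S"
  shows "\<not> biholomorphic S (conjugate_surface S) \<and> \<not> (\<exists>\<sigma>. real_structure S \<sigma>)"
proof -
  obtain \<beta> a b where S: "admissible \<beta>" "compatible \<beta> a b" "S = inoue_surface \<beta> a b"
    using assms unfolding type_I_inoue_surface_def by blast
  obtain m \<theta>\<^sub>1 \<theta>\<^sub>2 where "inoue \<beta> a b (1 / (cmod \<beta>)\<^sup>2) m \<theta>\<^sub>1 \<theta>\<^sub>2"
    using inoue_arithmetic[OF S(1,2) refl] .
  then have no_inj: "\<not> inj_on f (topspace (surface_top S))"
    if "holomorphic_map S (conjugate_surface S) f" for f
    using inoue.no_injective_antiholomorphic_map that unfolding S(3) by blast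
  have "\<not> biholomorphic S (conjugate_surface S)"
    unfolding biholomorphic_def using no_inj by (meson inj_on_inverseI)
  moreover have "\<not> real_structure S \<sigma>" for \<sigma>
    unfolding real_structure_def antiholomorphic_map_def using no_inj by (meson inj_on_inverseI)
  ultimately show ?thesis by blast
qed

end
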